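(* Let $m,r\in\mathbb N$, let $f\in\mathbb F_q[X]$ be monic irreducible of degree $m$ with root $\alpha\in\mathbb F_{q^m}$, and let $u_1,\dots,u_r\in\mathbb F_q[X]$ have degree less than $m$. The field-degree verification algorithm described in the context is correct, i.e., it returns True if and only if $\mathbb F_q(u_1(\alpha),\dots,u_r(\alpha))=\mathbb F_{q^m}$, and it requires the following number of operations: (i) The cost for the pre-computation in step 2 is $\mathcal O(m\log(m)\log(q)\,\mathsf M(m))$ operations in $\mathbb F_q$. (ii) Not considering the cost for the pre-computation, the cost for the algorithm is $\mathcal O(r\,m\log(m)\,\mathsf M(m))$ operations in $\mathbb F_q$. (iii) Assuming that the inputs $u_1,\dots,u_r$ are independent and identically uniformly distributed (among polynomials in $\mathbb F_q[X]$ of degree less than $m$), the average case (again not considering the pre-computation) only needs $\mathcal O(m\log(m)\,\mathsf M(m))$ operations in $\mathbb F_q$.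
   Context: Here $q$ is a prime power, and $\mathsf M(m)$ is the number of operations in $\mathbb F_q$ required to multiply two polynomials in $\mathbb F_q[X]$ of degree less than $m$ (e.g. $\mathcal O(m^2)$ for classical multiplication); multiplication in $R=\mathbb F_q[X]/(f)$ with $\deg f=m$ can be implemented using $\mathcal O(\mathsf M(m))$ operations in $\mathbb F_q$. Field-degree verification algorithm. Input: $m,r\in\mathbb N$, a monic irreducible $f\in\mathbb F_q[X]$ of degree $m$, and $u_1,\dots,u_r\in\mathbb F_q[X]$ of degree less than $m$. Step 1: Obtain the set $M=\{p_1,\dots,p_k\}$ of distinct prime factors of $m$. Step 2: Let $R=\mathbb F_q[X]/(f)$ and $\xi=X+(f)\in R$. Compute $\xi^{q^{m/p_1}},\dots,\xi^{q^{m/p_k}}$ using the square-and-multiply algorithm. Step 3: For $s=1,\dots,r$: use Horner's scheme to evaluate $u_s(\xi^{q^{m/p}})$ for all $p\in M$; whenever $u_s(\xi^{q^{m/p}})\neq u_s(\xi)$, remove $p$ from $M$; if $M=\emptyset$, return True and stop. Step 4: If the loop ends without returning, return False. The evaluation of $u_s(\xi)$ is free, since $u_s$ is itself the canonical representative of $u_s(\xi)$ in $R$. Costs count operations in $\mathbb F_q$ only (step 1 is not counted). *)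

theory Defs
  imports "HOL-Probability.Probability_Mass_Function" "HOL-Algebra.Algebra"
begin

text \<open>
  Throughout, \<open>L\<close> is the field with \<open>q^m\<close> elements and the subfield \<open>K\<close> of \<open>L\<close> is the field with
  \<open>q\<close> elements. As in HOL-Algebra, a polynomial is the list of its coefficients, leading
  coefficient first, without leading zeros.
\<close>

section \<open>Operations in the base field\<close>

text \<open>
  A multiplication routine is a straight-line program over \<open>K\<close>. Its registers are the inputs
  followed by the results of the instructions executed so far, and its cost is the number of
  instructions, each of which is one operation in \<open>K\<close>. Using constants of \<open>K\<close> and selecting
  registers as outputs is free. Division is made total by \<open>x / 0 = 0\<close>.
\<close>

datatype 'a operand = Reg nat | Cst 'a

datatype arith = Plus | Minus | Times | Over

type_synonym 'a slp = "(arith \<times> 'a operand \<times> 'a operand) list \<times> 'a operand list"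

primrec operand_val :: "'a list \<Rightarrow> 'a operand \<Rightarrow> 'a" where
  "operand_val env (Reg i) = env ! i"
| "operand_val env (Cst a) = a"

primrec arith_val :: "'a ring \<Rightarrow> arith \<Rightarrow> 'a \<Rightarrow> 'a \<Rightarrow> 'a" where
  "arith_val L Plus x y = x \<oplus>\<^bsub>L\<^esub> y"
| "arith_val L Minus x y = x \<ominus>\<^bsub>L\<^esub> y"
| "arith_val L Times x y = x \<otimes>\<^bsub>L\<^esub> y"
| "arith_val L Over x y = (if y = \<zero>\<^bsub>L\<^esub> then \<zero>\<^bsub>L\<^esub> else x \<otimes>\<^bsub>L\<^esub> inv\<^bsub>L\<^esub> y)"

definition run_slp :: "'a ring \<Rightarrow> 'a slp \<Rightarrow> 'a list \<Rightarrow> 'a list" where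
  "run_slp L P xs =
     (let env = fold (\<lambda>(g, s, t) e. e @ [arith_val L g (operand_val e s) (operand_val e t)]) (fst P) xs
      in map (operand_val env) (snd P))"

definition slp_cost :: "'a slp \<Rightarrow> nat" where
  "slp_cost P = length (fst P)"

primrec operand_ok :: "'a set \<Rightarrow> nat \<Rightarrow> 'a operand \<Rightarrow> bool" where
  "operand_ok K n (Reg i) \<longleftrightarrow> i < n"
| "operand_ok K n (Cst a) \<longleftrightarrow> a \<in> K"

definition slp_over :: "'a set \<Rightarrow> nat \<Rightarrow> 'a slp \<Rightarrow> bool" where
  "slp_over K n P \<longleftrightarrow>
     (\<forall>k < length (fst P). case fst P ! k of (g, s, t) \<Rightarrow>
        operand_ok K (n + k) s \<and> operand_ok K (n + k) t) \<and>
     (\<forall>s \<in> set (snd P). operand_ok K (n + length (fst P)) s)"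


section \<open>Multiplication of polynomials and multiplication in the quotient ring\<close>

text \<open>
  A polynomial of degree less than \<open>n\<close> is stored as a coefficient vector of length exactly \<open>n\<close>,
  again with the highest coefficient first; \<open>pad_poly L n\<close> and \<open>ring.normalize L\<close> translate
  between vectors and polynomials.
\<close>

definition coeff_vecs :: "'a set \<Rightarrow> nat \<Rightarrow> 'a list set" where
  "coeff_vecs K n = {v. length v = n \<and> set v \<subseteq> K}"

definition pad_poly :: "'a ring \<Rightarrow> nat \<Rightarrow> 'a list \<Rightarrow> 'a list" where
  "pad_poly L n p = replicate (n - length p) \<zero>\<^bsub>L\<^esub> @ p"

definition poly_mult_slp :: "'a ring \<Rightarrow> 'a set \<Rightarrow> nat \<Rightarrow> 'a slp \<Rightarrow> bool" where
  "poly_mult_slp L K n P \<longleftrightarrow>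
     slp_over K (2 * n) P \<and>
     (\<forall>a \<in> coeff_vecs K n. \<forall>b \<in> coeff_vecs K n.
        run_slp L P (a @ b) \<in> coeff_vecs K (2 * n - 1) \<and>
        ring.normalize L (run_slp L P (a @ b)) =
          ring.normalize L a \<otimes>\<^bsub>K[X]\<^bsub>L\<^esub>\<^esub> ring.normalize L b)"

definition mult_time :: "'a ring \<Rightarrow> 'a set \<Rightarrow> (nat \<Rightarrow> nat) \<Rightarrow> bool" where
  "mult_time L K M \<longleftrightarrow> (\<forall>n \<ge> 1. \<exists>P. poly_mult_slp L K n P \<and> slp_cost P \<le> M n)"

text \<open>
  An element of \<open>Rupt\<^bsub>L\<^esub> K f\<close>, the quotient of \<open>K[X]\<close> by \<open>(f)\<close>, is stored as the coefficient
  vector of its canonical representative, of degree less than \<open>degree f\<close>.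
\<close>

definition quot_mult_slp :: "'a ring \<Rightarrow> 'a set \<Rightarrow> 'a list \<Rightarrow> 'a slp \<Rightarrow> bool" where
  "quot_mult_slp L K f P \<longleftrightarrow>
     slp_over K (2 * degree f) P \<and>
     (\<forall>a \<in> coeff_vecs K (degree f). \<forall>b \<in> coeff_vecs K (degree f).
        run_slp L P (a @ b) \<in> coeff_vecs K (degree f) \<and>
        ring.rupture_surj L K f (ring.normalize L (run_slp L P (a @ b))) =
          ring.rupture_surj L K f (ring.normalize L a) \<otimes>\<^bsub>Rupt\<^bsub>L\<^esub> K f\<^esub>
          ring.rupture_surj L K f (ring.normalize L b))"


section \<open>The field-degree verification algorithm\<close>

text \<open>Every procedure returns its result together with the number of operations in \<open>K\<close>.\<close>

definition slp_mult :: "'a ring \<Rightarrow> 'a slp \<Rightarrow> 'a list \<Rightarrow> 'a list \<Rightarrow> 'a list \<times> nat" where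
  "slp_mult L P a b = (run_slp L P (a @ b), slp_cost P)"

fun square_multiply :: "('v \<Rightarrow> 'v \<Rightarrow> 'v \<times> nat) \<Rightarrow> 'v \<Rightarrow> 'v \<Rightarrow> nat \<Rightarrow> 'v \<times> nat" where
  "square_multiply mul e x n =
     (if n = 0 then (e, 0)
      else if n = 1 then (x, 0)
      else let (y, t0) = square_multiply mul e x (n div 2);
               (z, t1) = mul y y
           in if even n then (z, t0 + t1)
              else let (w, t2) = mul z x in (w, t0 + t1 + t2))"

declare square_multiply.simps [simp del]

text \<open>
  In Horner's scheme the coefficients of \<open>u\<close> lie in \<open>K\<close>, so adding one of them to an element of
  the quotient ring only changes the constant coefficient and is one operation.
\<close>

primrec horner_steps ::
    "'a ring \<Rightarrow> ('a list \<Rightarrow> 'a list \<Rightarrow> 'a list \<times> nat) \<Rightarrow> 'a list \<Rightarrow> 'a list \<Rightarrow> 'a list \<Rightarrow> 'a list \<times> nat" where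
  "horner_steps L mul b acc [] = (acc, 0)"
| "horner_steps L mul b acc (c # cs) =
     (let (v, t1) = mul acc b;
          (w, t2) = horner_steps L mul b (butlast v @ [last v \<oplus>\<^bsub>L\<^esub> c]) cs
      in (w, t1 + 1 + t2))"

definition horner ::
    "'a ring \<Rightarrow> nat \<Rightarrow> ('a list \<Rightarrow> 'a list \<Rightarrow> 'a list \<times> nat) \<Rightarrow> 'a list \<Rightarrow> 'a list \<Rightarrow> 'a list \<times> nat" where
  "horner L m mul u b =
     (case u of [] \<Rightarrow> (pad_poly L m [], 0)
      | c # cs \<Rightarrow> horner_steps L mul b (pad_poly L m [c]) cs)"

text \<open>
  Steps 1 and 2; for each prime factor \<open>p\<close> of \<open>m\<close> the second component of the pair is
  the power of the residue class of \<open>X\<close> with exponent \<open>q^(m/p)\<close>.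
\<close>

definition precomputation ::
    "'a ring \<Rightarrow> 'a set \<Rightarrow> nat \<Rightarrow> 'a list \<Rightarrow> 'a slp \<Rightarrow> (nat \<times> 'a list) list \<times> nat" where
  "precomputation L K m f P =
     (let ps = sorted_list_of_set (prime_factors m);
          xi = pad_poly L m (ring.pmod L X\<^bsub>L\<^esub> f);
          bts = map (\<lambda>p. square_multiply (slp_mult L P) (pad_poly L m [\<one>\<^bsub>L\<^esub>]) xi
                            (card K ^ (m div p))) ps
      in (zip ps (map fst bts), sum_list (map snd bts)))"

text \<open>
  One round of step 3. Comparing two elements of the quotient ring costs \<open>m\<close> operations, one
  for each coefficient.
\<close>

primrec remove_primes ::
    "'a ring \<Rightarrow> nat \<Rightarrow> 'a slp \<Rightarrow> 'a list \<Rightarrow> (nat \<times> 'a list) list \<Rightarrow> (nat \<times> 'a list) list \<times> nat" where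
  "remove_primes L m P u [] = ([], 0)"
| "remove_primes L m P u (pb # M) =
     (let (v, t1) = horner L m (slp_mult L P) u (snd pb);
          (M', t2) = remove_primes L m P u M
      in (if v \<noteq> pad_poly L m u then M' else pb # M', t1 + m + t2))"

primrec verification_loop ::
    "'a ring \<Rightarrow> nat \<Rightarrow> 'a slp \<Rightarrow> (nat \<times> 'a list) list \<Rightarrow> 'a list list \<Rightarrow> bool \<times> nat" where
  "verification_loop L m P M [] = (False, 0)"
| "verification_loop L m P M (u # us) =
     (let (M', t) = remove_primes L m P u M
      in if M' = [] then (True, t)
         else let (b, t') = verification_loop L m P M' us in (b, t + t'))"

text \<open>The result is the answer, the cost of step 2, and the cost of all other steps.\<close>

definition field_degree_verification ::
    "'a ring \<Rightarrow> 'a set \<Rightarrow> nat \<Rightarrow> 'a list \<Rightarrow> 'a slp \<Rightarrow> 'a list list \<Rightarrow> bool \<times> nat \<times> nat" where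
  "field_degree_verification L K m f P us =
     (let (M, t2) = precomputation L K m f P;
          (b, t3) = verification_loop L m P M us
      in (b, t2, t3))"

definition answer :: "'a ring \<Rightarrow> 'a set \<Rightarrow> nat \<Rightarrow> 'a list \<Rightarrow> 'a slp \<Rightarrow> 'a list list \<Rightarrow> bool" where
  "answer L K m f P us = fst (field_degree_verification L K m f P us)"

definition precomputation_cost :: "'a ring \<Rightarrow> 'a set \<Rightarrow> nat \<Rightarrow> 'a list \<Rightarrow> 'a slp \<Rightarrow> 'a list list \<Rightarrow> nat" where
  "precomputation_cost L K m f P us = fst (snd (field_degree_verification L K m f P us))"

definition main_cost :: "'a ring \<Rightarrow> 'a set \<Rightarrow> nat \<Rightarrow> 'a list \<Rightarrow> 'a slp \<Rightarrow> 'a list list \<Rightarrow> nat" where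
  "main_cost L K m f P us = snd (snd (field_degree_verification L K m f P us))"

definition polys_below :: "'a ring \<Rightarrow> 'a set \<Rightarrow> nat \<Rightarrow> 'a list set" where
  "polys_below L K m = {u \<in> carrier (K[X]\<^bsub>L\<^esub>). degree u < m}"

end

theory Submission
  imports Defs
begin

text \<open>
  The polynomials of degree below \<open>m\<close> correspond to the elements of \<open>L\<close> by evaluation at \<open>\<alpha>\<close>, and
  since the \<open>q\<close>-power map is a field automorphism fixing \<open>K\<close>, the test of the algorithm for \<open>p\<close> asks
  whether \<open>u(\<alpha>)\<close> is fixed by \<open>x \<mapsto> x^(q^(m/p))\<close>. A proper subfield containing \<open>K\<close> has \<open>q^d\<close>
  elements with \<open>d\<close> a proper divisor of \<open>m\<close>, so it is fixed by one of these maps; conversely such a map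
  has at most \<open>q^(m/p) < q^m\<close> fixed points. The number of prime factors of \<open>m\<close> is at most
  \<open>log 2 m\<close>, which gives the worst-case bounds. A uniformly random \<open>u\<close> passes the test for \<open>p\<close>
  with probability at most \<open>1/2\<close>, so each prime factor is tested at most twice in expectation.
\<close>

section \<open>Finite fields\<close>

text \<open>Root counting applies to the normalization of \<open>p\<close>: if it were nonempty, its
  degree would be smaller than \<open>length p\<close> and yet at least the number of roots.
  Bounding the length instead of a degree admits lists with leading zeros.\<close>

lemma (in field) eval_zero_if_many_roots:
  assumes p: "set p \<subseteq> carrier R" and A: "finite A" "A \<subseteq> carrier R"
    and len: "length p \<le> card A" and roots: "\<And>x. x \<in> A \<Longrightarrow> eval p x = \<zero>" and y: "y \<in> carrier R"
  shows "eval p y = \<zero>"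
proof -
  define n where "n = normalize p"
  have n: "n \<in> carrier (poly_ring R)"
    unfolding n_def univ_poly_carrier[symmetric] by (rule normalize_gives_polynomial[OF p])
  have ev: "eval n x = eval p x" if "x \<in> carrier R" for x
    unfolding n_def using eval_normalize[OF p that] .
  have "n = []"
  proof (rule ccontr)
    assume "n \<noteq> []"
    have "mset_set A \<subseteq># roots n"
    proof (rule mset_subset_eqI)
      fix a
      show "count (mset_set A) a \<le> count (roots n) a"
      proof (cases "a \<in> A")
        case True
        hence "is_root n a"
          using A ev roots \<open>n \<noteq> []\<close> unfolding is_root_def by auto
        hence "a \<in># roots n" using roots_mem_iff_is_root[OF n] by blast
        thus ?thesis using True A by (simp add: Suc_leI)
      qed simp
    qed
    hence "card A \<le> size (roots n)" using size_mset_mono by fastforce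
    hence "card A \<le> degree n" using size_roots_le_degree[OF n] by linarith
    moreover have "length n \<le> length p" unfolding n_def by (rule normalize_length_le)
    moreover have "length n > 0" using \<open>n \<noteq> []\<close> by simp
    ultimately show False using len by linarith
  qed
  thus ?thesis using ev[OF y] by simp
qed

section \<open>The \<open>q\<close>-power map as a ring homomorphism\<close>

text \<open>The leading terms of \<open>(x + y)^n\<close> and \<open>x^n\<close> cancel, so their
  difference is a polynomial in \<open>x\<close> of degree below \<open>n\<close>. Only this degree
  bound matters later, so its coefficients stay unspecified.\<close>

lemma (in cring) shifted_power_expansion:
  assumes y: "y \<in> carrier R"
  shows "\<exists>p. set p \<subseteq> carrier R \<and> length p \<le> n \<and>
    (\<forall>x \<in> carrier R. (x \<oplus> y) [^] n = x [^] n \<oplus> eval p x)"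
proof (induction n)
  case 0
  show ?case by (rule exI[of _ "[]"]) simp
next
  case (Suc n)
  then obtain p where p: "set p \<subseteq> carrier R" "length p \<le> n"
    and eq: "\<And>x. x \<in> carrier R \<Longrightarrow> (x \<oplus> y) [^] n = x [^] n \<oplus> eval p x" by blast
  \<comment> \<open>The three summands come from
    \<open>(x^n + p(x)) (x + y) = x^(n+1) + y x^n + x p(x) + y p(x)\<close>; appending a zero
    multiplies by \<open>x\<close>.\<close>
  define s where "s = poly_add (monom y n) (poly_add (p @ [\<zero>]) (map (\<lambda>a. y \<otimes> a) p))"
  have c1: "set (monom y n) \<subseteq> carrier R" unfolding monom_def using y by auto
  have c2: "set (p @ [\<zero>]) \<subseteq> carrier R" using p by auto
  have c3: "set (map (\<lambda>a. y \<otimes> a) p) \<subseteq> carrier R" using p y by auto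
  have c23: "set (poly_add (p @ [\<zero>]) (map (\<lambda>a. y \<otimes> a) p)) \<subseteq> carrier R"
    by (rule poly_add_in_carrier[OF c2 c3])
  have smult: "eval (map (\<lambda>a. y \<otimes> a) r) x = y \<otimes> eval r x"
    if "set r \<subseteq> carrier R" "x \<in> carrier R" for r x
    using that(1)
  proof (induction r)
    case (Cons b r)
    have "eval r x \<in> carrier R" "x [^] length r \<in> carrier R"
      using Cons eval_in_carrier that by auto
    thus ?case using Cons y that(2) by (simp add: r_distr m_assoc)
  qed (simp add: y)
  have "set s \<subseteq> carrier R" unfolding s_def by (rule poly_add_in_carrier[OF c1 c23])
  moreover have "length s \<le> Suc n"
  proof -
    have "length (poly_add (p @ [\<zero>]) (map (\<lambda>a. y \<otimes> a) p)) \<le> Suc n"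
      using poly_add_length_le[of "p @ [\<zero>]" "map (\<lambda>a. y \<otimes> a) p"] p(2) by simp
    thus ?thesis unfolding s_def
      using poly_add_length_le[of "monom y n" "poly_add (p @ [\<zero>]) (map (\<lambda>a. y \<otimes> a) p)"]
      by (simp add: monom_def)
  qed
  moreover have "(x \<oplus> y) [^] Suc n = x [^] Suc n \<oplus> eval s x" if x: "x \<in> carrier R" for x
  proof -
    have e: "eval p x \<in> carrier R" "x [^] n \<in> carrier R" using eval_in_carrier p x by auto
    have "eval s x = y \<otimes> x [^] n \<oplus> (eval p x \<otimes> x \<oplus> y \<otimes> eval p x)"
      unfolding s_def
      using e y x p by (simp add: eval_poly_add[OF c1 c23 x] eval_poly_add[OF c2 c3 x]
          eval_monom eval_append_aux smult del: poly_add.simps)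
    thus ?thesis using e x y eq[OF x] by (simp, algebra)
  qed
  ultimately show ?case by blast
qed

text \<open>A nonzero \<open>x\<close> lies in the unit group of \<open>K\<close>, whose order is
  \<open>card K - 1\<close>; one more factor \<open>x\<close> gives the claim. For zero the exponent
  has to be positive.\<close>

lemma (in field) subfield_power_card:
  assumes K: "subfield K R" and fin: "finite K" and x: "x \<in> K"
  shows "x [^] card K = x"
proof (cases "x = \<zero>")
  case True
  have "card K \<noteq> 0" using fin x by auto
  thus ?thesis using True by (simp add: nat_pow_zero)
next
  case False
  interpret K: field "R \<lparr>carrier := K\<rparr>" by (rule subfield_iff(2)[OF K])
  have U: "Units (R \<lparr>carrier := K\<rparr>) = K - {\<zero>}" using K.field_Units by simp
  have "x [^]\<^bsub>R \<lparr>carrier := K\<rparr>\<^esub> card (Units (R \<lparr>carrier := K\<rparr>)) = \<one>"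
    using K.units_power_order_eq_one[of x] fin U x False by simp
  hence "x [^] (card K - 1) = \<one>"
    using U fin subringE(2)[OF subfieldE(1)[OF K]] by (simp add: nat_pow_consistent[symmetric] card_Diff_singleton)
  moreover have "card K \<noteq> 0" using fin x by auto
  then obtain k where "card K = Suc k" by (cases "card K") auto
  moreover have "x \<in> carrier R" using subfieldE(3)[OF K] x by auto
  ultimately show ?thesis by simp
qed

text \<open>
  Two applications of one idea: \<open>(x + y)^q - x^q - y^q\<close>, as a polynomial in \<open>x\<close>, has degree below
  \<open>q\<close>, so it vanishes identically once it vanishes on \<open>K\<close>. This avoids binomial coefficients
  and the characteristic.
\<close>

lemma (in field) frobenius_add:
  assumes K: "subfield K R" and fin: "finite K" and x: "x \<in> carrier R" and y: "y \<in> carrier R"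
  shows "(x \<oplus> y) [^] card K = x [^] card K \<oplus> y [^] card K"
proof -
  let ?q = "card K"
  have KR: "K \<subseteq> carrier R" by (rule subfieldE(3)[OF K])
  have q: "?q \<noteq> 0" using fin subringE(2)[OF subfieldE(1)[OF K]] by auto
  have step: "(x \<oplus> y) [^] ?q = x [^] ?q \<oplus> y [^] ?q"
    if y: "y \<in> carrier R" and x: "x \<in> carrier R"
      and onK: "\<And>z. z \<in> K \<Longrightarrow> (z \<oplus> y) [^] ?q = z [^] ?q \<oplus> y [^] ?q" for x y
  proof -
    obtain p where p: "set p \<subseteq> carrier R" "length p \<le> ?q"
      and eq: "\<And>x. x \<in> carrier R \<Longrightarrow> (x \<oplus> y) [^] ?q = x [^] ?q \<oplus> eval p x"
      using shifted_power_expansion[OF y, of ?q] by blast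
    define s where "s = poly_add p [\<ominus> (y [^] ?q)]"
    have c: "set [\<ominus> (y [^] ?q)] \<subseteq> carrier R" using y by simp
    have s: "set s \<subseteq> carrier R" unfolding s_def by (rule poly_add_in_carrier[OF p(1) c])
    have len: "length s \<le> ?q"
      using poly_add_length_le[of p "[\<ominus> (y [^] ?q)]"] p(2) q unfolding s_def by simp
    have ev: "eval s z = eval p z \<ominus> y [^] ?q" if "z \<in> carrier R" for z
      unfolding s_def using eval_poly_add[OF p(1) c that] y that eval_in_carrier[OF p(1) that]
      by (simp add: a_minus_def)
    have "eval s z = \<zero>" if "z \<in> K" for z
    proof -
      have z: "z \<in> carrier R" using that KR by auto
      have "z [^] ?q \<oplus> eval p z = z [^] ?q \<oplus> y [^] ?q" using eq[OF z] onK[OF that] by simp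
      hence "eval p z = y [^] ?q"
        using z y eval_in_carrier[OF p(1) z] add.l_cancel[of "z [^] ?q" "eval p z" "y [^] ?q"] by blast
      thus ?thesis using ev[OF z] y by simp
    qed
    hence "eval s x = \<zero>"
      using eval_zero_if_many_roots[OF s fin KR len _ x] by blast
    hence "eval p x = y [^] ?q"
      using ev[OF x] x y eval_in_carrier[OF p(1) x] by simp
    thus ?thesis using eq[OF x] by simp
  qed
  have K_add: "(z \<oplus> w) [^] ?q = z [^] ?q \<oplus> w [^] ?q" if "z \<in> K" "w \<in> K" for z w
    using subfield_power_card[OF K fin] that subringE(7)[OF subfieldE(1)[OF K]] by simp
  \<comment> \<open>The first use of \<open>step\<close> frees one argument while the other stays in
    \<open>K\<close>. After commuting the sum, this is the hypothesis \<open>onK\<close> for an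
    arbitrary fixed \<open>y\<close>, so a second use frees the remaining argument.\<close>
  have K_R_add: "(z \<oplus> w) [^] ?q = z [^] ?q \<oplus> w [^] ?q" if "z \<in> carrier R" "w \<in> K" for z w
    using step[of w z] K_add that KR by blast
  show ?thesis
  proof (rule step[OF y x])
    fix z assume "z \<in> K"
    thus "(z \<oplus> y) [^] ?q = z [^] ?q \<oplus> y [^] ?q"
      using K_R_add[OF y, of z] KR y by (auto simp: a_comm)
  qed
qed

lemma (in field) frobenius_iterate_hom:
  assumes K: "subfield K R" and fin: "finite K"
  shows "ring_hom_ring R R (\<lambda>x. x [^] (card K ^ j))"
proof (rule ring_hom_ringI[OF ring_axioms ring_axioms])
  fix x y assume x: "x \<in> carrier R" and y: "y \<in> carrier R"
  show "(x \<oplus> y) [^] (card K ^ j) = x [^] (card K ^ j) \<oplus> y [^] (card K ^ j)"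
  proof (induction j)
    case (Suc j)
    have "z [^] (card K ^ Suc j) = (z [^] (card K ^ j)) [^] card K" if "z \<in> carrier R" for z
      using that by (simp add: nat_pow_pow mult.commute)
    thus ?case using Suc x y frobenius_add[OF K fin] by simp
  qed (simp add: x y)
  show "(x \<otimes> y) [^] (card K ^ j) = x [^] (card K ^ j) \<otimes> y [^] (card K ^ j)"
    using x y by (rule nat_pow_distrib)
qed simp_all

lemma (in field) subfield_iterated_power_card:
  assumes "subfield K R" "finite K" "x \<in> K"
  shows "x [^] (card K ^ j) = x"
proof (induction j)
  case (Suc j)
  have x: "x \<in> carrier R" using subfieldE(3)[OF assms(1)] assms(3) by auto
  have "x [^] (card K ^ Suc j) = (x [^] (card K ^ j)) [^] card K"
    using x by (simp add: nat_pow_pow mult.commute)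
  thus ?case using Suc subfield_power_card[OF assms] by simp
next
  case 0
  have "x \<in> carrier R" using subfieldE(3)[OF assms(1)] assms(3) by auto
  thus ?case by simp
qed

section \<open>Fixed points of power maps\<close>

text \<open>The points where a ring endomorphism agrees with the identity form a subring. For
  inverses, the power of \<open>inv k\<close> is again inverse to the fixed element
  \<open>k\<close>, and inverses are unique.\<close>

lemma (in field) fixed_points_subfield:
  assumes K: "subfield K R" and fin: "finite K"
  shows "subfield {x \<in> carrier R. x [^] (card K ^ j) = x} R"
proof -
  interpret h: ring_hom_ring R R "\<lambda>x. x [^] (card K ^ j)"
    by (rule frobenius_iterate_hom[OF K fin])
  show ?thesis
  proof (rule subfieldI'[OF subringI])
    fix k assume "k \<in> {x \<in> carrier R. x [^] (card K ^ j) = x} - {\<zero>}"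
    hence k: "k \<in> Units R" "k [^] (card K ^ j) = k" by (auto simp: field_Units)
    have kc: "k \<in> carrier R" "inv k \<in> carrier R" using k(1) by auto
    have "(k \<otimes> inv k) [^] (card K ^ j) = k \<otimes> (inv k [^] (card K ^ j))"
      using nat_pow_distrib[OF kc] k(2) by simp
    hence "inv k = inv k [^] (card K ^ j)"
      using k(1) kc by (intro comm_inv_char) simp_all
    thus "inv k \<in> {x \<in> carrier R. x [^] (card K ^ j) = x}" using kc by simp
  qed auto
qed

text \<open>A nonzero fixed point satisfies \<open>x^(n-1) = 1\<close>, which has at most
  \<open>n - 1\<close> solutions since \<open>n - 1 > 0\<close>; zero adds one more.\<close>

lemma (in field) card_power_fixed_points_le:
  assumes fin: "finite (carrier R)" and n: "n > 1"
  shows "card {x \<in> carrier R. x [^] (n::nat) = x} \<le> n"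
proof -
  have "{x \<in> carrier R. x [^] n = x} \<subseteq> insert \<zero> {x \<in> carrier R. x [^] (n - 1) = \<one>}"
  proof
    fix x assume "x \<in> {x \<in> carrier R. x [^] n = x}"
    hence x: "x \<in> carrier R" "x [^] n = x" by auto
    have "x [^] n = x [^] (n - 1) \<otimes> x"
      using n x(1) nat_pow_Suc[of x "n - 1"] by simp
    hence "x [^] (n - 1) \<otimes> x = \<one> \<otimes> x" using x by simp
    hence "x = \<zero> \<or> x [^] (n - 1) = \<one>"
      using m_rcancel[of x "x [^] (n - 1)" \<one>] x by auto
    thus "x \<in> insert \<zero> {x \<in> carrier R. x [^] (n - 1) = \<one>}" using x by auto
  qed
  hence "card {x \<in> carrier R. x [^] n = x} \<le> card (insert \<zero> {x \<in> carrier R. x [^] (n - 1) = \<one>})"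
    by (rule card_mono[rotated]) (simp add: fin)
  also have "\<dots> \<le> Suc (n - 1)"
    using num_roots_le_deg[OF fin, of "n - 1"] n fin by (intro order_trans[OF card_insert_le_m1]) auto
  finally show ?thesis using n by simp
qed

section \<open>Cardinalities of subfields by linear algebra\<close>

text \<open>Coordinates are unique: two representations give \<open>(k - k') v = w' - w\<close> in
  \<open>V\<close>, and dividing by a nonzero \<open>k - k'\<close> would put \<open>v\<close> into
  \<open>V\<close>. Each adjoined vector thus multiplies the cardinality by
  \<open>card K\<close>.\<close>

lemma (in ring) card_line_extension:
  assumes K: "subfield K R" and V: "subalgebra K V R" and v: "v \<in> carrier R" "v \<notin> V"
  shows "bij_betw (\<lambda>(k, w). k \<otimes> v \<oplus> w) (K \<times> V) (line_extension K v V)"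
proof -
  interpret V: subalgebra K V R by (rule V)
  have KR: "K \<subseteq> carrier R" and VR: "V \<subseteq> carrier R"
    using subfieldE(3)[OF K] V.subset by auto
  note subK = subringE[OF subfieldE(1)[OF K]]
  have "k = k' \<and> w = w'"
    if k: "k \<in> K" "k' \<in> K" and w: "w \<in> V" "w' \<in> V" and eq: "k \<otimes> v \<oplus> w = k' \<otimes> v \<oplus> w'" for k k' w w'
  proof -
    have c: "k \<in> carrier R" "k' \<in> carrier R" "w \<in> carrier R" "w' \<in> carrier R"
      using k w KR VR by auto
    have d: "(k \<ominus> k') \<otimes> v = w' \<ominus> w"
    proof -
      have "(k \<ominus> k') \<otimes> v = (k \<otimes> v \<oplus> w) \<ominus> w \<ominus> k' \<otimes> v" using c v(1) by algebra
      also have "\<dots> = w' \<ominus> w" unfolding eq using c v(1) by algebra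
      finally show ?thesis .
    qed
    have mem: "w' \<ominus> w \<in> V"
      using V.m_closed[OF w(2) V.m_inv_closed[OF w(1)]] by (simp add: a_minus_def a_inv_def)
    have kk: "k \<ominus> k' \<in> K" using subK(5,7) k by (simp add: a_minus_def)
    have "k \<ominus> k' = \<zero>"
    proof (rule ccontr)
      assume nz: "k \<ominus> k' \<noteq> \<zero>"
      have i: "inv (k \<ominus> k') \<in> K" "inv (k \<ominus> k') \<otimes> (k \<ominus> k') = \<one>"
        using subfield_m_inv[OF K] kk nz by auto
      have "v = inv (k \<ominus> k') \<otimes> (w' \<ominus> w)"
        unfolding d[symmetric] using i c v(1) KR by (auto simp: m_assoc[symmetric])
      thus False using V.smult_closed[OF i(1) mem] v(2) by simp
    qed
    hence "k = k'" using c by simp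
    moreover have "w' \<ominus> w = \<zero>" using d \<open>k \<ominus> k' = \<zero>\<close> v(1) by simp
    ultimately show ?thesis using c by simp
  qed
  hence "inj_on (\<lambda>(k, w). k \<otimes> v \<oplus> w) (K \<times> V)"
    by (intro inj_onI) auto
  moreover have "(\<lambda>(k, w). k \<otimes> v \<oplus> w) ` (K \<times> V) = line_extension K v V"
    by (force simp: line_extension_mem_iff)
  ultimately show ?thesis by (simp add: bij_betw_def)
qed

lemma (in ring) card_dimension:
  assumes K: "subfield K R" and dim: "dimension n K E"
  shows "card E = card K ^ n"
  using dim
proof (induction n arbitrary: E)
  case 0
  show ?case using dimension_zero[OF K "0.prems"] by simp
next
  case (Suc n)
  from Suc.prems obtain v V where v: "v \<in> carrier R" "v \<notin> V" "dimension n K V"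
    and E: "E = line_extension K v V"
    by (cases rule: dimension.cases) auto
  have "subalgebra K V R"
    by (rule finite_dimension_imp_subalgebra[OF K finite_dimensionI[OF v(3)]])
  hence "card (K \<times> V) = card E"
    unfolding E using card_line_extension[OF K _ v(1,2)] by (blast intro: bij_betw_same_card)
  thus ?case using Suc.IH[OF v(3)] by (simp add: card_cartesian_product)
qed

text \<open>Since \<open>F\<close> is finite, the list of all its elements spans it over
  \<open>K\<close>, so its dimension is finite.\<close>

lemma (in field) card_subfield_power:
  assumes K: "subfield K R" and F: "subfield F R" and KF: "K \<subseteq> F" and fin: "finite (carrier R)"
  shows "\<exists>d. card F = card K ^ d"
proof -
  note subF = subringE[OF subfieldE(1)[OF F]]
  have FR: "F \<subseteq> carrier R" by (rule subfieldE(3)[OF F])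
  hence "finite F" by (rule finite_subset[OF _ fin])
  then obtain Us where Us: "set Us = F" using finite_list by blast
  have alg: "subalgebra K F R"
    using subF KF subfieldE(1)[OF F]
    unfolding subalgebra_def subalgebra_axioms_def subring_def by auto
  have "Span K Us = F"
    using Span_base_incl[OF K, of Us] subalgebra_Span_incl[OF K alg, of Us] Us FR by auto
  hence "finite_dimension K F" using Span_finite_dimension[OF K, of Us] Us FR by auto
  thus ?thesis using card_dimension[OF K] by blast
qed

text \<open>The tower law by counting: applying the previous lemma to \<open>F\<close> over
  \<open>K\<close> and to the whole field over \<open>F\<close> gives \<open>q^m = q^(d e)\<close>,
  and \<open>q > 1\<close> allows the exponents to be compared.\<close>

lemma (in field) card_intermediate_subfield:
  assumes K: "subfield K R" and F: "subfield F R" and KF: "K \<subseteq> F" and fin: "finite (carrier R)"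
    and card: "card (carrier R) = card K ^ m"
  obtains d where "card F = card K ^ d" "d dvd m"
proof -
  obtain d where d: "card F = card K ^ d" using card_subfield_power[OF K F KF fin] by blast
  obtain e where "card (carrier R) = card F ^ e"
    using card_subfield_power[OF F carrier_is_subfield subfieldE(3)[OF F] fin] by blast
  hence "card K ^ m = card K ^ (d * e)" using d card by (simp add: power_mult)
  moreover have "card K > 1"
  proof -
    have "card {\<zero>, \<one>} \<le> card K"
      using subringE(2,3)[OF subfieldE(1)[OF K]] finite_subset[OF subfieldE(3)[OF K] fin]
      by (intro card_mono) auto
    thus ?thesis by simp
  qed
  ultimately have "m = d * e" by simp
  thus thesis using that d by simp
qed

section \<open>Evaluation at the root\<close>

text \<open>Residue classes modulo \<open>f\<close> are studied through their values at
  \<open>\<alpha>\<close>, the image of the class of \<open>X\<close>. Correctness arguments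
  therefore take place in \<open>L\<close>.\<close>

locale monic_irreducible_root = field L for L :: "'a ring" (structure) +
  fixes K :: "'a set" and m :: nat and f :: "'a list" and \<alpha> :: 'a
  assumes finite_carrier: "finite (carrier L)"
    and subfield: "subfield K L"
    and m_pos: "1 \<le> m"
    and card_carrier: "card (carrier L) = card K ^ m"
    and f_closed: "f \<in> carrier (K[X])"
    and f_irreducible: "pirreducible K f"
    and f_monic: "lead_coeff f = \<one>"
    and degree_f: "degree f = m"
    and root_closed: "\<alpha> \<in> carrier L"
    and root: "eval f \<alpha> = \<zero>"
begin

lemmas subring = subfieldE(1)[OF subfield]

lemma K_subset: "K \<subseteq> carrier L"
  by (rule subfieldE(3)[OF subfield])

lemma finite_K: "finite K"
  using K_subset finite_carrier by (rule finite_subset)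

lemma card_K: "card K \<ge> 2"
proof -
  have "card {\<zero>, \<one>} \<le> card K"
    using subringE(2,3)[OF subring] finite_K by (intro card_mono) auto
  thus ?thesis by simp
qed

lemma f_nonzero: "f \<noteq> []"
  using degree_f m_pos by auto

text \<open>A monic irreducible polynomial with root \<open>\<alpha>\<close> is the minimal
  polynomial of \<open>\<alpha>\<close>, whose known properties then pass to
  \<open>f\<close>.\<close>

lemma eval_ker: "a_kernel (K[X]) L (\<lambda>p. eval p \<alpha>) = PIdl\<^bsub>K[X]\<^esub> f"
  and eval_zero_imp_pdivides: "\<lbrakk>p \<in> carrier (K[X]); eval p \<alpha> = \<zero>\<rbrakk> \<Longrightarrow> f pdivides p"
proof -
  have alg: "(algebraic over K) \<alpha>" using algebraicI[OF f_closed f_nonzero root] .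
  note Irr = IrrE[OF subfield root_closed alg]
  have "f = Irr K \<alpha>"
    using minimal_polynomial_is_unique[OF subfield root_closed alg]
      Irr f_closed f_irreducible f_monic root by blast
  thus "a_kernel (K[X]) L (\<lambda>p. eval p \<alpha>) = PIdl\<^bsub>K[X]\<^esub> f"
    and "\<lbrakk>p \<in> carrier (K[X]); eval p \<alpha> = \<zero>\<rbrakk> \<Longrightarrow> f pdivides p"
    using Irr_generates_ker[OF subfield root_closed alg]
      Irr_minimal[OF subfield root_closed alg] by auto
qed

lemma poly_set: "u \<in> carrier (K[X]) \<Longrightarrow> set u \<subseteq> K"
  unfolding univ_poly_carrier[symmetric] polynomial_def by auto

section \<open>Canonical representatives, coefficient vectors and values at the root\<close>

text \<open>The difference of two such polynomials with equal values vanishes at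
  \<open>\<alpha>\<close>, so \<open>f\<close> divides it; its degree is below that of
  \<open>f\<close>, so it is zero.\<close>

lemma eval_inj: "inj_on (\<lambda>u. eval u \<alpha>) (polys_below L K m)"
proof (rule inj_onI)
  fix u w assume u: "u \<in> polys_below L K m" and w: "w \<in> polys_below L K m"
    and eq: "eval u \<alpha> = eval w \<alpha>"
  interpret UP: domain "K[X]" by (rule univ_poly_is_domain[OF subring])
  interpret ev: ring_hom_ring "K[X]" L "\<lambda>p. eval p \<alpha>"
    by (rule eval_ring_hom[OF subring root_closed])
  have c: "u \<in> carrier (K[X])" "w \<in> carrier (K[X])" "degree u < m" "degree w < m"
    using u w by (auto simp: polys_below_def)
  define d where "d = u \<ominus>\<^bsub>K[X]\<^esub> w"
  have d: "d \<in> carrier (K[X])" unfolding d_def using c by simp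
  have "eval d \<alpha> = \<zero>" unfolding d_def using c eq by (simp add: a_minus_def UP.minus_eq r_neg)
  hence dvd: "f pdivides d" by (rule eval_zero_imp_pdivides[OF d])
  have "degree d \<le> max (degree u) (degree w)"
    unfolding d_def UP.minus_eq univ_poly_add
    using poly_add_degree[of u "\<ominus>\<^bsub>K[X]\<^esub> w"] univ_poly_a_inv_degree[OF subring c(2)] by simp
  hence "degree d < degree f" using c degree_f by simp
  hence "d = []" using pdivides_imp_degree_le[OF subring f_closed d _ dvd] by auto
  thus "u = w" using c UP.r_right_minus_eq[of u w] unfolding d_def univ_poly_zero by simp
qed

lemma length_le: "u \<in> polys_below L K m \<Longrightarrow> length u \<le> m"
  unfolding polys_below_def by (cases u) auto

lemma pad_poly_coeff_vecs: "u \<in> polys_below L K m \<Longrightarrow> pad_poly L m u \<in> coeff_vecs K m"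
  using length_le[of u] poly_set[of u] subringE(2)[OF subring]
  by (auto simp: polys_below_def pad_poly_def coeff_vecs_def)

lemma eval_pad_poly:
  "\<lbrakk>set u \<subseteq> carrier L; x \<in> carrier L\<rbrakk> \<Longrightarrow> eval (pad_poly L n u) x = eval u x"
  unfolding pad_poly_def by (rule eval_replicate)

lemma normalize_coeff_vecs: "v \<in> coeff_vecs K m \<Longrightarrow> normalize v \<in> polys_below L K m"
  using normalize_length_le[of v] m_pos normalize_gives_polynomial[of v K]
  by (auto simp: coeff_vecs_def polys_below_def univ_poly_carrier[symmetric])

lemma pad_normalize: "length v = n \<Longrightarrow> pad_poly L n (normalize v) = v"
  using normalize_def'[of v] normalize_length_le[of v] unfolding pad_poly_def by metis

lemma normalize_pad: "u \<in> polys_below L K m \<Longrightarrow> normalize (pad_poly L m u) = u"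
  unfolding pad_poly_def normalize_replicate_zero
  by (rule normalize_polynomial[of K]) (simp add: polys_below_def univ_poly_carrier)

lemma length_coeff_vecs: "v \<in> coeff_vecs K m \<Longrightarrow> length v = m"
  by (simp add: coeff_vecs_def)

lemma coeff_vecs_set: "v \<in> coeff_vecs K m \<Longrightarrow> set v \<subseteq> carrier L"
  using K_subset by (auto simp: coeff_vecs_def)

text \<open>This lets the comparison of vectors in the algorithm be read as a comparison of values
  in \<open>L\<close>.\<close>

lemma coeff_vecs_eqI:
  assumes "v \<in> coeff_vecs K m" "w \<in> coeff_vecs K m" "eval v \<alpha> = eval w \<alpha>"
  shows "v = w"
proof -
  have "normalize v = normalize w"
  proof (rule inj_onD[OF eval_inj])
    show "eval (normalize v) \<alpha> = eval (normalize w) \<alpha>"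
      using assms(3) by (simp add: eval_normalize[OF coeff_vecs_set root_closed] assms(1,2))
  qed (rule assms(1,2)[THEN normalize_coeff_vecs])+
  hence "pad_poly L m (normalize v) = pad_poly L m (normalize w)" by simp
  thus ?thesis unfolding assms(1,2)[THEN length_coeff_vecs, THEN pad_normalize] .
qed

lemma card_polys_below: "card (polys_below L K m) = card K ^ m"
proof -
  have "bij_betw (pad_poly L m) (polys_below L K m) (coeff_vecs K m)"
    by (rule bij_betw_byWitness[where f' = normalize])
      (use pad_poly_coeff_vecs normalize_coeff_vecs in
        \<open>auto simp: normalize_pad pad_normalize length_coeff_vecs\<close>)
  hence "card (polys_below L K m) = card (coeff_vecs K m)" by (rule bij_betw_same_card)
  also have "coeff_vecs K m = {xs. set xs \<subseteq> K \<and> length xs = m}" by (auto simp: coeff_vecs_def)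
  also have "card \<dots> = card K ^ m" by (rule card_lists_length_eq[OF finite_K])
  finally show ?thesis .
qed

text \<open>Members of one coset differ by an element of the ideal of \<open>f\<close>, which is the
  kernel of evaluation at \<open>\<alpha>\<close>.\<close>

lemma rupture_surj_eq_imp_eval_eq:
  assumes p: "p \<in> carrier (K[X])" and q: "q \<in> carrier (K[X])"
    and eq: "rupture_surj K f p = rupture_surj K f q"
  shows "eval p \<alpha> = eval q \<alpha>"
proof -
  interpret UP: domain "K[X]" by (rule univ_poly_is_domain[OF subring])
  interpret ev: ring_hom_ring "K[X]" L "\<lambda>p. eval p \<alpha>"
    by (rule eval_ring_hom[OF subring root_closed])
  interpret I: ideal "PIdl\<^bsub>K[X]\<^esub> f" "K[X]" by (rule UP.cgenideal_ideal[OF f_closed])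
  have "p \<in> PIdl\<^bsub>K[X]\<^esub> f +>\<^bsub>K[X]\<^esub> q"
    using I.a_rcos_self[OF p] eq by simp
  then obtain i where i: "i \<in> PIdl\<^bsub>K[X]\<^esub> f" "p = i \<oplus>\<^bsub>K[X]\<^esub> q"
    unfolding a_r_coset_def' by blast
  have "i \<in> carrier (K[X])" "eval i \<alpha> = \<zero>"
    using i(1) unfolding eval_ker[symmetric] a_kernel_def' by auto
  thus ?thesis using i(2) q by simp
qed

lemma eval_poly_closed: "u \<in> carrier (K[X]) \<Longrightarrow> x \<in> carrier L \<Longrightarrow> eval u x \<in> carrier L"
  using eval_in_carrier poly_set K_subset by blast

section \<open>The test for one prime factor\<close>

text \<open>For a prime factor \<open>p\<close> of \<open>m\<close>, the elements of
  \<open>L\<close> with this property form the maximal proper subfield of degree \<open>m/p\<close>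
  over \<open>K\<close>.\<close>

definition fixes_power :: "nat \<Rightarrow> 'a \<Rightarrow> bool" where
  "fixes_power p x \<longleftrightarrow> x [^] (card K ^ (m div p)) = x"

text \<open>The power map is a homomorphism and fixes the coefficients of \<open>u\<close>, so it
  commutes with evaluation. This links the Horner value at a power of \<open>\<alpha>\<close> to
  \<open>fixes_power\<close>.\<close>

lemma eval_power:
  assumes u: "u \<in> carrier (K[X])" and x: "x \<in> carrier L"
  shows "eval u (x [^] (card K ^ j)) = eval u x [^] (card K ^ j)"
proof -
  interpret h: ring_hom_ring L L "\<lambda>x. x [^] (card K ^ j)"
    by (rule frobenius_iterate_hom[OF subfield finite_K])
  have "map (\<lambda>x. x [^] (card K ^ j)) u = u"
    by (rule map_idI) (use subfield_iterated_power_card[OF subfield finite_K] poly_set[OF u] in blast)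
  thus ?thesis using h.eval_hom'[OF x, of u] poly_set[OF u] K_subset by auto
qed

text \<open>If all of \<open>S\<close> passed the test for some \<open>p\<close>, the fixed field of
  that power map would contain the generated field but have too few elements to be \<open>L\<close>.
  Conversely, a proper generated field has degree \<open>d\<close> over \<open>K\<close> with
  \<open>d\<close> properly dividing \<open>m\<close>, and any prime factor of \<open>m/d\<close>
  yields a test that all of \<open>S\<close> passes.\<close>

lemma generate_field_eq_carrier_iff:
  assumes S: "S \<subseteq> carrier L"
  shows "generate_field L (K \<union> S) = carrier L \<longleftrightarrow>
    (\<forall>p \<in> prime_factors m. \<exists>x \<in> S. \<not> fixes_power p x)"
proof
  assume gen: "generate_field L (K \<union> S) = carrier L"
  show "\<forall>p \<in> prime_factors m. \<exists>x \<in> S. \<not> fixes_power p x"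
  proof (rule ballI, rule ccontr)
    fix p assume p: "p \<in> prime_factors m" and "\<not> (\<exists>x \<in> S. \<not> fixes_power p x)"
    hence S_fixed: "\<forall>x \<in> S. fixes_power p x" by simp
    define Q where "Q = card K ^ (m div p)"
    have p1: "p > 1" "p dvd m" using p prime_gt_1_nat[of p] by (auto simp: in_prime_factors_iff)
    hence "0 < m div p" "m div p < m" using m_pos by (auto simp: dvd_div_eq_0_iff)
    hence Q: "1 < Q" "Q < card K ^ m"
      unfolding Q_def using card_K by (intro one_less_power, auto)
    have sub: "subfield {x \<in> carrier L. x [^] Q = x} L"
      unfolding Q_def by (rule fixed_points_subfield[OF subfield finite_K])
    have "K \<union> S \<subseteq> {x \<in> carrier L. x [^] Q = x}"
      using S_fixed S subfield_iterated_power_card[OF subfield finite_K] K_subset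
      unfolding fixes_power_def Q_def by auto
    hence "carrier L \<subseteq> {x \<in> carrier L. x [^] Q = x}"
      using generate_field_min_subfield1[OF _ sub, of "K \<union> S"] S K_subset gen by blast
    hence "card (carrier L) \<le> card {x \<in> carrier L. x [^] Q = x}"
      using finite_carrier by (intro card_mono) auto
    also have "\<dots> \<le> Q" by (rule card_power_fixed_points_le[OF finite_carrier Q(1)])
    finally show False using Q(2) card_carrier by simp
  qed
next
  assume moved: "\<forall>p \<in> prime_factors m. \<exists>x \<in> S. \<not> fixes_power p x"
  define F where "F = generate_field L (K \<union> S)"
  have F: "subfield F L" "K \<union> S \<subseteq> F"
    unfolding F_def using generate_field_is_subfield[of "K \<union> S"] S K_subset
    by (auto intro: generate_field.incl)
  have FL: "F \<subseteq> carrier L" and finF: "finite F"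
    using subfieldE(3)[OF F(1)] finite_subset finite_carrier by auto
  obtain d where d: "card F = card K ^ d" "d dvd m"
    using card_intermediate_subfield[OF subfield F(1) _ finite_carrier card_carrier] F(2) by auto
  have "d = m"
  proof (rule ccontr)
    assume "d \<noteq> m"
    obtain e where e: "m = d * e" using d(2) by blast
    hence "e \<noteq> 1" using \<open>d \<noteq> m\<close> by auto
    then obtain p where p: "normalization_semidom_class.prime p" "p dvd e" using prime_factor_nat by blast
    then obtain k where k: "e = p * k" by blast
    have "p \<in> prime_factors m"
      using p e m_pos by (auto simp: in_prime_factors_iff)
    then obtain x where x: "x \<in> S" "\<not> fixes_power p x" using moved by blast
    \<comment> \<open>Now \<open>q^(m/p)\<close> is the \<open>k\<close>-th power of
      \<open>card F\<close>, so the test for \<open>p\<close> applies an iterate of the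
      \<open>card F\<close>-power map, which fixes \<open>F\<close> pointwise.\<close>
    have "m div p = d * k" using e k p(1) by (auto simp: prime_gt_0_nat)
    hence "card K ^ (m div p) = card F ^ k" by (simp add: d(1) power_mult)
    hence "fixes_power p x"
      unfolding fixes_power_def using subfield_iterated_power_card[OF F(1) finF, of x k] x F(2) by auto
    thus False using x by simp
  qed
  thus "generate_field L (K \<union> S) = carrier L"
    using card_subset_eq[OF finite_carrier FL] d(1) card_carrier unfolding F_def by simp
qed

text \<open>Evaluation embeds the passing polynomials into the at most \<open>q^(m/p)\<close> fixed
  points. The factor \<open>2\<close> is absorbed by one factor \<open>q\<close>, because
  \<open>m/p + 1 \<le> m\<close>.\<close>

lemma card_fixes_power_le:
  assumes p: "p \<in> prime_factors m"
  shows "2 * card {u \<in> polys_below L K m. fixes_power p (eval u \<alpha>)} \<le> card (polys_below L K m)"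
proof -
  define Q where "Q = card K ^ (m div p)"
  have p1: "p > 1" "p dvd m" using p prime_gt_1_nat[of p] by (auto simp: in_prime_factors_iff)
  hence less: "0 < m div p" "m div p < m" using m_pos by (auto simp: dvd_div_eq_0_iff)
  hence Q: "1 < Q" unfolding Q_def using card_K by (intro one_less_power) auto
  have "card {u \<in> polys_below L K m. fixes_power p (eval u \<alpha>)} =
      card ((\<lambda>u. eval u \<alpha>) ` {u \<in> polys_below L K m. fixes_power p (eval u \<alpha>)})"
    by (rule card_image[symmetric], rule inj_on_subset[OF eval_inj]) auto
  also have "\<dots> \<le> card {x \<in> carrier L. x [^] Q = x}"
    using finite_carrier eval_poly_closed root_closed unfolding Q_def
    by (intro card_mono) (auto simp: fixes_power_def polys_below_def)
  also have "\<dots> \<le> Q" by (rule card_power_fixed_points_le[OF finite_carrier Q])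
  finally have "2 * card {u \<in> polys_below L K m. fixes_power p (eval u \<alpha>)} \<le> card K * Q"
    using card_K by (intro mult_mono) auto
  also have "\<dots> = card K ^ Suc (m div p)" unfolding Q_def by simp
  also have "\<dots> \<le> card K ^ m" using less card_K by (intro power_increasing) auto
  finally show ?thesis by (simp add: card_polys_below)
qed

end

section \<open>Correctness and cost of the algorithm\<close>

text \<open>Each halving of the exponent costs at most two multiplications, and exponent
  \<open>1\<close> is free.\<close>

lemma square_multiply_cost_le:
  assumes mul: "\<And>a b. snd (mul a b) = (t :: nat)" and n: "n \<ge> 1"
  shows "real (snd (square_multiply mul e x n)) \<le> 2 * real t * log 2 (real n)"
  using n
proof (induction n rule: less_induct)
  case (less n)
  show ?case
  proof (cases "n = 1")
    case True
    thus ?thesis by (simp add: square_multiply.simps)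
  next
    case False
    hence n2: "n \<ge> 2" using less.prems by simp
    hence d: "n div 2 < n" "1 \<le> n div 2" by auto
    have "snd (square_multiply mul e x n) \<le> snd (square_multiply mul e x (n div 2)) + 2 * t"
      using False n2 mul[unfolded surjective_pairing]
      by (subst square_multiply.simps) (auto simp: Let_def case_prod_beta mul)
    hence "real (snd (square_multiply mul e x n)) \<le> 2 * real t * log 2 (real (n div 2)) + 2 * real t"
      using less.IH[OF d] by linarith
    \<comment> \<open>The extra \<open>2 t\<close> pays for doubling the argument of the logarithm;
      rounding is harmless since \<open>2 (n div 2) \<le> n\<close>.\<close>
    also have "\<dots> = 2 * real t * log 2 (real (2 * (n div 2)))"
      using d by (simp add: log_mult algebra_simps)
    also have "\<dots> \<le> 2 * real t * log 2 (real n)"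
      using d by (intro mult_left_mono log_mono) (auto simp flip: of_nat_mult)
    finally show ?thesis .
  qed
qed

text \<open>The leading coefficient only initializes the accumulator; each of the others costs one
  multiplication and one addition.\<close>

lemma horner_cost_le:
  assumes "\<And>a b. snd (mul a b) = t"
  shows "snd (horner L m mul u b) \<le> degree u * (t + 1)"
proof -
  have "snd (horner_steps L mul b acc cs) = length cs * (t + 1)" for acc cs
    by (induction cs arbitrary: acc) (auto simp: case_prod_beta assms)
  thus ?thesis by (cases u) (auto simp: horner_def)
qed

text \<open>The summand \<open>2\<close> collects the addition in each Horner step and the
  comparison of \<open>m\<close> coefficients.\<close>

lemma remove_primes_cost_le:
  assumes "degree u \<le> m"
  shows "snd (remove_primes L m P u M) \<le> length M * (m * (slp_cost P + 2))"
proof -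
  have "snd (horner L m (slp_mult L P) u b) + m \<le> m * (slp_cost P + 2)" for b
  proof -
    have "snd (horner L m (slp_mult L P) u b) \<le> degree u * (slp_cost P + 1)"
      by (rule horner_cost_le) (simp add: slp_mult_def)
    also have "\<dots> \<le> m * (slp_cost P + 1)" using assms by (rule mult_le_mono1)
    finally show ?thesis by simp
  qed
  note b = this
  show ?thesis
  proof (induction M)
    case (Cons pb M)
    thus ?case using b[of "snd pb"] by (simp add: case_prod_beta)
  qed simp
qed

lemma fst_remove_primes:
  "fst (remove_primes L m P u M) =
     filter (\<lambda>pb. fst (horner L m (slp_mult L P) u (snd pb)) = pad_poly L m u) M"
  by (induction M) (simp_all add: case_prod_beta)

lemma snd_verification_loop_Cons:
  "snd (verification_loop L m P M (u # us)) =
     snd (remove_primes L m P u M) +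
     (if fst (remove_primes L m P u M) = [] then 0
      else snd (verification_loop L m P (fst (remove_primes L m P u M)) us))"
  by (simp add: case_prod_beta)

text \<open>The list only shrinks, so every round is bounded by the cost for the initial
  list.\<close>

lemma verification_loop_cost_le:
  assumes "\<And>u. u \<in> set us \<Longrightarrow> degree u \<le> m"
  shows "snd (verification_loop L m P M us) \<le> length us * (length M * (m * (slp_cost P + 2)))"
  using assms
proof (induction us arbitrary: M)
  case (Cons u us)
  let ?M = "fst (remove_primes L m P u M)"
  have "length ?M \<le> length M" unfolding fst_remove_primes by simp
  hence "length us * (length ?M * (m * (slp_cost P + 2))) \<le> length us * (length M * (m * (slp_cost P + 2)))"
    by (intro mult_le_mono) auto
  moreover have "snd (remove_primes L m P u M) \<le> length M * (m * (slp_cost P + 2))"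
    using Cons.prems[of u] by (intro remove_primes_cost_le) simp
  moreover have "snd (verification_loop L m P ?M us) \<le> length us * (length ?M * (m * (slp_cost P + 2)))"
    using Cons.prems by (intro Cons.IH) (meson list.set_intros(2))
  moreover have "length (u # us) * (length M * (m * (slp_cost P + 2))) =
      length M * (m * (slp_cost P + 2)) + length us * (length M * (m * (slp_cost P + 2)))"
    by simp
  moreover have "snd (verification_loop L m P M (u # us)) \<le>
      snd (remove_primes L m P u M) + snd (verification_loop L m P ?M us)"
    unfolding snd_verification_loop_Cons by simp
  ultimately show ?case by linarith
qed simp

text \<open>Each prime power in the factorization of \<open>n\<close> is at least
  \<open>2\<close>.\<close>

lemma card_prime_factors_le_log:
  assumes "n \<ge> 1"
  shows "real (card (prime_factors n)) \<le> log 2 (real n)"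
proof -
  have "2 ^ card (prime_factors n) = (\<Prod>p \<in> prime_factors n. (2::nat))" by simp
  also have "\<dots> \<le> (\<Prod>p \<in> prime_factors n. p ^ multiplicity p n)"
  proof (rule prod_mono)
    fix p assume p: "p \<in> prime_factors n"
    hence "p \<ge> 2" using prime_ge_2_nat[of p] by (auto simp: in_prime_factors_iff)
    moreover have "multiplicity p n \<ge> 1"
      using p by (simp add: prime_factors_multiplicity)
    ultimately have "2 \<le> p" "p ^ 1 \<le> p ^ multiplicity p n"
      by simp_all (intro self_le_power; simp)
    thus "0 \<le> (2::nat) \<and> 2 \<le> p ^ multiplicity p n" by simp
  qed
  also have "\<dots> = n" using assms by (simp add: prime_factorization_nat[symmetric])
  finally show ?thesis by (rule le_log2_of_power)
qed

section \<open>Correctness of the arithmetic on coefficient vectors\<close>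

locale quotient_multiplication = monic_irreducible_root +
  fixes P :: "'a slp"
  assumes quot_mult: "quot_mult_slp L K f P"
begin

text \<open>The routine is specified by residue classes only. The homomorphism property of
  \<open>rupture_surj\<close> turns this into congruence with the product polynomial, and congruent
  polynomials agree at \<open>\<alpha>\<close>.\<close>

lemma slp_mult_correct:
  assumes a: "a \<in> coeff_vecs K m" and b: "b \<in> coeff_vecs K m"
  shows "fst (slp_mult L P a b) \<in> coeff_vecs K m"
    and "eval (fst (slp_mult L P a b)) \<alpha> = eval a \<alpha> \<otimes> eval b \<alpha>"
proof -
  let ?w = "run_slp L P (a @ b)"
  interpret UP: domain "K[X]" by (rule univ_poly_is_domain[OF subring])
  interpret ev: ring_hom_ring "K[X]" L "\<lambda>p. eval p \<alpha>"
    by (rule eval_ring_hom[OF subring root_closed])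
  have w: "?w \<in> coeff_vecs K m"
    and rs: "rupture_surj K f (normalize ?w) =
      rupture_surj K f (normalize a) \<otimes>\<^bsub>Rupt K f\<^esub> rupture_surj K f (normalize b)"
    using quot_mult a b unfolding quot_mult_slp_def degree_f by auto
  thus "fst (slp_mult L P a b) \<in> coeff_vecs K m" by (simp add: slp_mult_def)
  have c: "normalize v \<in> carrier (K[X])" if "v \<in> coeff_vecs K m" for v
    using normalize_coeff_vecs[OF that] by (simp add: polys_below_def)
  have "rupture_surj K f (normalize ?w) = rupture_surj K f (normalize a \<otimes>\<^bsub>K[X]\<^esub> normalize b)"
    unfolding rs using ring_hom_mult[OF rupture_surj_hom(1)[OF subring f_closed] c[OF a] c[OF b]] by simp
  hence "eval (normalize ?w) \<alpha> = eval (normalize a \<otimes>\<^bsub>K[X]\<^esub> normalize b) \<alpha>"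
    by (rule rupture_surj_eq_imp_eval_eq[rotated 2]) (use c a b w in auto)
  also have "\<dots> = eval (normalize a) \<alpha> \<otimes> eval (normalize b) \<alpha>" using c a b by simp
  finally show "eval (fst (slp_mult L P a b)) \<alpha> = eval a \<alpha> \<otimes> eval b \<alpha>"
    by (simp add: slp_mult_def eval_normalize[OF coeff_vecs_set root_closed] a b w)
qed

lemma eval_coeff_vecs_closed: "v \<in> coeff_vecs K m \<Longrightarrow> eval v \<alpha> \<in> carrier L"
  by (rule eval_in_carrier[OF coeff_vecs_set root_closed])

text \<open>Vectors start with the highest coefficient, so the constant one is the last entry; it
  exists because \<open>m \<ge> 1\<close>.\<close>

lemma add_constant_coefficient:
  assumes v: "v \<in> coeff_vecs K m" and c: "c \<in> K"
  shows "butlast v @ [last v \<oplus> c] \<in> coeff_vecs K m"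
    and "eval (butlast v @ [last v \<oplus> c]) \<alpha> = eval v \<alpha> \<oplus> c"
proof -
  have ne: "v \<noteq> []" using v m_pos by (auto simp: coeff_vecs_def)
  have K: "last v \<in> K" "set (butlast v) \<subseteq> K"
    using v ne by (auto simp: coeff_vecs_def dest: in_set_butlastD)
  show "butlast v @ [last v \<oplus> c] \<in> coeff_vecs K m"
    using v ne K c subringE(7)[OF subring] m_pos by (auto simp: coeff_vecs_def)
  have cl: "set (butlast v) \<subseteq> carrier L" "last v \<in> carrier L" "c \<in> carrier L" "last v \<oplus> c \<in> carrier L"
    using K c K_subset by auto
  have "eval v \<alpha> = eval (butlast v @ [last v]) \<alpha>" using ne by simp
  also have "\<dots> = eval (butlast v) \<alpha> \<otimes> \<alpha> \<oplus> last v"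
    by (rule eval_append_aux[OF cl(1,2) root_closed])
  finally show "eval (butlast v @ [last v \<oplus> c]) \<alpha> = eval v \<alpha> \<oplus> c"
    using eval_append_aux[OF cl(1,4) root_closed] cl eval_in_carrier[OF cl(1) root_closed] root_closed
    by (simp add: a_assoc)
qed

text \<open>The loop invariant for an arbitrary accumulator: each pending coefficient multiplies the
  accumulated value by one more factor \<open>eval b \<alpha>\<close>.\<close>

lemma horner_steps_correct:
  assumes "acc \<in> coeff_vecs K m" "b \<in> coeff_vecs K m" "set cs \<subseteq> K"
  shows "fst (horner_steps L (slp_mult L P) b acc cs) \<in> coeff_vecs K m \<and>
    eval (fst (horner_steps L (slp_mult L P) b acc cs)) \<alpha> =
      eval acc \<alpha> \<otimes> eval b \<alpha> [^] length cs \<oplus> eval cs (eval b \<alpha>)"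
  using assms(1,3)
proof (induction cs arbitrary: acc)
  case Nil
  thus ?case using eval_coeff_vecs_closed by simp
next
  case (Cons c cs)
  let ?v = "fst (slp_mult L P acc b)"
  let ?acc = "butlast ?v @ [last ?v \<oplus> c]"
  note v = slp_mult_correct[OF Cons.prems(1) assms(2)]
  have c: "c \<in> K" and cs: "set cs \<subseteq> K" using Cons.prems by auto
  note acc = add_constant_coefficient[OF v(1) c]
  have cl: "eval acc \<alpha> \<in> carrier L" "eval b \<alpha> \<in> carrier L" "c \<in> carrier L"
      "eval b \<alpha> [^] length cs \<in> carrier L" "eval cs (eval b \<alpha>) \<in> carrier L"
    using eval_coeff_vecs_closed[OF Cons.prems(1)] eval_coeff_vecs_closed[OF assms(2)] c cs K_subset
    by (auto intro: eval_in_carrier)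
  have "eval b \<alpha> [^] Suc (length cs) = eval b \<alpha> \<otimes> eval b \<alpha> [^] length cs"
    using cl nat_pow_Suc2 by blast
  thus ?case
    using Cons.IH[OF acc(1) cs] cl acc(2) v(2)
    by (simp add: case_prod_beta l_distr m_assoc a_assoc del: nat_pow_Suc)
qed

lemma horner_correct:
  assumes u: "u \<in> polys_below L K m" and b: "b \<in> coeff_vecs K m"
  shows "fst (horner L m (slp_mult L P) u b) \<in> coeff_vecs K m"
    and "eval (fst (horner L m (slp_mult L P) u b)) \<alpha> = eval u (eval b \<alpha>)"
proof -
  have nil: "[] \<in> polys_below L K m"
    using m_pos by (simp add: polys_below_def univ_poly_carrier[symmetric] polynomial_def)
  have "fst (horner L m (slp_mult L P) u b) \<in> coeff_vecs K m \<and>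
    eval (fst (horner L m (slp_mult L P) u b)) \<alpha> = eval u (eval b \<alpha>)"
  proof (cases u)
    case Nil
    thus ?thesis using pad_poly_coeff_vecs[OF nil] eval_pad_poly[of "[]" \<alpha>] root_closed
      by (simp add: horner_def)
  next
    case (Cons c cs)
    have c: "c \<in> K" "set cs \<subseteq> K"
      using u Cons poly_set[of u] by (auto simp: polys_below_def)
    have pad: "pad_poly L m [c] \<in> coeff_vecs K m"
      using c m_pos subringE(2)[OF subring] by (auto simp: pad_poly_def coeff_vecs_def)
    have "eval (pad_poly L m [c]) \<alpha> = c"
      using eval_pad_poly[of "[c]" \<alpha>] c K_subset root_closed by auto
    thus ?thesis using horner_steps_correct[OF pad b c(2)] Cons by (simp add: horner_def)
  qed
  thus "fst (horner L m (slp_mult L P) u b) \<in> coeff_vecs K m"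
    and "eval (fst (horner L m (slp_mult L P) u b)) \<alpha> = eval u (eval b \<alpha>)" by auto
qed

lemma square_multiply_correct:
  assumes x: "x \<in> coeff_vecs K m" and n: "n \<ge> 1"
  shows "fst (square_multiply (slp_mult L P) e x n) \<in> coeff_vecs K m \<and>
    eval (fst (square_multiply (slp_mult L P) e x n)) \<alpha> = eval x \<alpha> [^] n"
  using n
proof (induction n rule: less_induct)
  case (less n)
  have xc: "eval x \<alpha> \<in> carrier L" by (rule eval_coeff_vecs_closed[OF x])
  show ?case
  proof (cases "n = 1")
    case True
    thus ?thesis using x xc by (simp add: square_multiply.simps)
  next
    case False
    hence d: "n div 2 < n" "1 \<le> n div 2" using less.prems by auto
    define y where "y = fst (square_multiply (slp_mult L P) e x (n div 2))"
    define z where "z = fst (slp_mult L P y y)"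
    have y: "y \<in> coeff_vecs K m" "eval y \<alpha> = eval x \<alpha> [^] (n div 2)"
      using less.IH[OF d] unfolding y_def by auto
    have z: "z \<in> coeff_vecs K m" "eval z \<alpha> = eval x \<alpha> [^] (n div 2 + n div 2)"
      using slp_mult_correct[OF y(1) y(1)] xc unfolding z_def by (auto simp: y(2) nat_pow_mult)
    have eq: "fst (square_multiply (slp_mult L P) e x n) = (if even n then z else fst (slp_mult L P z x))"
      using False less.prems unfolding z_def y_def
      by (subst square_multiply.simps) (simp add: case_prod_beta)
    show ?thesis
    proof (cases "even n")
      case True
      hence "n div 2 + n div 2 = n" by presburger
      thus ?thesis using z eq True by simp
    next
      case odd: False
      hence "n = Suc (n div 2 + n div 2)" by presburger
      hence "eval x \<alpha> [^] n = eval z \<alpha> \<otimes> eval x \<alpha>" using z(2) nat_pow_Suc by metis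
      thus ?thesis using slp_mult_correct[OF z(1) x] eq odd by simp
    qed
  qed
qed

section \<open>The answer of the verification loop\<close>

text \<open>The invariant of the list \<open>M\<close>, preserved by filtering, which is all that a
  round does to it.\<close>

definition correct_powers :: "(nat \<times> 'a list) list \<Rightarrow> bool" where
  "correct_powers M \<longleftrightarrow> (\<forall>pb \<in> set M. fst pb \<in> prime_factors m \<and> snd pb \<in> coeff_vecs K m \<and>
     eval (snd pb) \<alpha> = \<alpha> [^] (card K ^ (m div fst pb)))"

lemma fst_remove_primes_eq:
  assumes M: "correct_powers M" and u: "u \<in> polys_below L K m"
  shows "fst (remove_primes L m P u M) = filter (\<lambda>pb. fixes_power (fst pb) (eval u \<alpha>)) M"
  unfolding fst_remove_primes
proof (rule filter_cong[OF refl])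
  fix pb assume "pb \<in> set M"
  hence b: "snd pb \<in> coeff_vecs K m" "eval (snd pb) \<alpha> = \<alpha> [^] (card K ^ (m div fst pb))"
    using M by (auto simp: correct_powers_def)
  let ?v = "fst (horner L m (slp_mult L P) u (snd pb))"
  have uc: "u \<in> carrier (K[X])" "set u \<subseteq> carrier L"
    using u poly_set[of u] K_subset by (auto simp: polys_below_def)
  note v = horner_correct[OF u b(1)]
  have "?v = pad_poly L m u \<longleftrightarrow> eval ?v \<alpha> = eval (pad_poly L m u) \<alpha>"
    using coeff_vecs_eqI[OF v(1) pad_poly_coeff_vecs[OF u]] by auto
  also have "\<dots> \<longleftrightarrow> fixes_power (fst pb) (eval u \<alpha>)"
    unfolding v(2) b(2) eval_pad_poly[OF uc(2) root_closed] eval_power[OF uc(1) root_closed] fixes_power_def ..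
  finally show "?v = pad_poly L m u \<longleftrightarrow> fixes_power (fst pb) (eval u \<alpha>)" .
qed

lemma correct_powers_filter: "correct_powers M \<Longrightarrow> correct_powers (filter Q M)"
  by (auto simp: correct_powers_def)

text \<open>The loop checks for an empty list only after a round. Without any polynomial it answers
  False even if \<open>M\<close> is empty, as happens for \<open>m = 1\<close>; hence the conjunct
  \<open>us \<noteq> []\<close>.\<close>

lemma fst_verification_loop:
  assumes "correct_powers M" "set us \<subseteq> polys_below L K m"
  shows "fst (verification_loop L m P M us) \<longleftrightarrow>
    us \<noteq> [] \<and> (\<forall>pb \<in> set M. \<exists>u \<in> set us. \<not> fixes_power (fst pb) (eval u \<alpha>))"
  using assms
proof (induction us arbitrary: M)
  case (Cons u us)
  let ?M = "filter (\<lambda>pb. fixes_power (fst pb) (eval u \<alpha>)) M"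
  have M: "fst (remove_primes L m P u M) = ?M"
    using fst_remove_primes_eq Cons.prems by simp
  have IH: "fst (verification_loop L m P ?M us) \<longleftrightarrow>
    us \<noteq> [] \<and> (\<forall>pb \<in> set ?M. \<exists>u \<in> set us. \<not> fixes_power (fst pb) (eval u \<alpha>))"
    using Cons.IH[OF correct_powers_filter[OF Cons.prems(1)]] Cons.prems(2) by simp
  have "fst (verification_loop L m P M (u # us)) \<longleftrightarrow>
      ?M = [] \<or> fst (verification_loop L m P ?M us)"
    using M by (simp add: case_prod_beta)
  also have "\<dots> \<longleftrightarrow> (\<forall>pb \<in> set M. \<exists>u \<in> set (u # us). \<not> fixes_power (fst pb) (eval u \<alpha>))"
  proof (cases "us = []")
    case False
    thus ?thesis unfolding IH filter_empty_conv set_filter list.set by blast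
  qed (auto simp: filter_empty_conv)
  finally show ?case by simp
qed simp

section \<open>The average case\<close>

lemma finite_polys_below: "finite (polys_below L K m)"
  using card_polys_below card_K by (intro card_ge_0_finite) simp

text \<open>Linearity of expectation in counting form: each pair survives a round for at most half
  of the polynomials, so the average number of survivors is at most half of
  \<open>length M\<close>.\<close>

lemma sum_length_fixed_le:
  assumes "correct_powers M"
  shows "2 * (\<Sum>u \<in> polys_below L K m. length (filter (\<lambda>pb. fixes_power (fst pb) (eval u \<alpha>)) M))
    \<le> length M * card (polys_below L K m)"
  using assms
proof (induction M)
  case (Cons pb M)
  let ?U = "polys_below L K m"
  let ?F = "\<lambda>pb u. fixes_power (fst pb) (eval u \<alpha>)"
  have "length (filter (\<lambda>pb. ?F pb u) (pb # M)) =
      (if ?F pb u then 1 else 0) + length (filter (\<lambda>pb. ?F pb u) M)" for u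
    by simp
  hence "(\<Sum>u \<in> ?U. length (filter (\<lambda>pb. ?F pb u) (pb # M))) =
      (\<Sum>u \<in> ?U. if ?F pb u then 1 else 0) + (\<Sum>u \<in> ?U. length (filter (\<lambda>pb. ?F pb u) M))"
    by (simp add: sum.distrib)
  also have "(\<Sum>u \<in> ?U. if ?F pb u then 1 else 0) = card {u \<in> ?U. ?F pb u}"
    using finite_polys_below by (simp add: sum.If_cases Int_def)
  finally have "2 * (\<Sum>u \<in> ?U. length (filter (\<lambda>pb. ?F pb u) (pb # M))) =
    2 * card {u \<in> ?U. ?F pb u} + 2 * (\<Sum>u \<in> ?U. length (filter (\<lambda>pb. ?F pb u) M))" by simp
  also have "\<dots> \<le> card ?U + length M * card ?U"
    using Cons card_fixes_power_le[of "fst pb"] by (intro add_mono) (auto simp: correct_powers_def)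
  finally show ?case by simp
qed simp

text \<open>Expected list lengths at least halve in every round, so the costs are dominated by a
  geometric series with sum \<open>2\<close>, whatever \<open>r\<close> is. In the induction, one
  round costs at most \<open>length M\<close> units and the rest on average twice half of
  that.\<close>

lemma expected_verification_loop_cost_le:
  assumes "correct_powers M"
  shows "measure_pmf.expectation (replicate_pmf r (pmf_of_set (polys_below L K m)))
      (\<lambda>us. real (snd (verification_loop L m P M us)))
    \<le> 2 * real (length M) * real (m * (slp_cost P + 2))"
  using assms
proof (induction r arbitrary: M)
  case 0
  show ?case by simp
next
  case (Suc r)
  let ?U = "polys_below L K m"
  let ?B = "real (m * (slp_cost P + 2))"
  let ?M = "\<lambda>u. filter (\<lambda>pb. fixes_power (fst pb) (eval u \<alpha>)) M"
  let ?D = "replicate_pmf r (pmf_of_set ?U)"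
  let ?E = "\<lambda>M. measure_pmf.expectation ?D (\<lambda>us. real (snd (verification_loop L m P M us)))"
  have U: "finite ?U" "?U \<noteq> {}" using finite_polys_below card_polys_below card_K by auto
  have finD: "finite (set_pmf ?D)"
    using U finite_lists_length_eq[OF U(1), of r]
    by (auto simp: set_replicate_pmf intro: finite_subset[rotated])
  have step: "measure_pmf.expectation (map_pmf ((#) u) ?D) (\<lambda>us. real (snd (verification_loop L m P M us)))
      \<le> real (length M) * ?B + 2 * real (length (?M u)) * ?B" if u: "u \<in> ?U" for u
  proof -
    have "measure_pmf.expectation (map_pmf ((#) u) ?D) (\<lambda>us. real (snd (verification_loop L m P M us))) =
        measure_pmf.expectation ?D (\<lambda>us. real (snd (verification_loop L m P M (u # us))))"
      by simp
    also have "\<dots> \<le> measure_pmf.expectation ?D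
        (\<lambda>us. real (length M) * ?B + real (snd (verification_loop L m P (?M u) us)))"
    proof (rule integral_mono)
      fix us
      have "snd (remove_primes L m P u M) \<le> length M * (m * (slp_cost P + 2))"
        using u by (intro remove_primes_cost_le) (simp add: polys_below_def)
      \<comment> \<open>An early return costs nothing more, so continuing with the filtered list is
        an upper bound in both branches.\<close>
      hence "snd (verification_loop L m P M (u # us)) \<le>
          length M * (m * (slp_cost P + 2)) + snd (verification_loop L m P (?M u) us)"
        unfolding snd_verification_loop_Cons fst_remove_primes_eq[OF Suc.prems u] by simp
      thus "real (snd (verification_loop L m P M (u # us))) \<le>
          real (length M) * ?B + real (snd (verification_loop L m P (?M u) us))"
        by (simp flip: of_nat_mult of_nat_add del: of_nat_Suc)
    qed (rule integrable_measure_pmf_finite[OF finD])+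
    also have "\<dots> = real (length M) * ?B + ?E (?M u)"
      by (subst Bochner_Integration.integral_add) (auto intro: integrable_measure_pmf_finite[OF finD])
    also have "\<dots> \<le> real (length M) * ?B + 2 * real (length (?M u)) * ?B"
      using Suc.IH[OF correct_powers_filter[OF Suc.prems]] by simp
    finally show ?thesis .
  qed
  \<comment> \<open>Conditioning on the first polynomial: the expectation is the average over
    \<open>u\<close> of the expectations for the independent rest.\<close>
  have "measure_pmf.expectation (replicate_pmf (Suc r) (pmf_of_set ?U))
      (\<lambda>us. real (snd (verification_loop L m P M us))) =
    (\<Sum>u\<in>?U. measure_pmf.expectation (map_pmf ((#) u) ?D)
        (\<lambda>us. real (snd (verification_loop L m P M us))) /\<^sub>R real (card ?U))"
    unfolding replicate_pmf.simps map_pmf_def[symmetric]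
    by (rule pmf_expectation_bind_pmf_of_set[OF U(2,1)]) (use finD in simp)
  also have "\<dots> \<le> (\<Sum>u\<in>?U. (real (length M) * ?B + 2 * real (length (?M u)) * ?B) /\<^sub>R real (card ?U))"
    using step by (intro sum_mono scaleR_left_mono) auto
  also have "\<dots> = (real (card ?U) * real (length M) * ?B +
      real (2 * (\<Sum>u\<in>?U. length (?M u))) * ?B) / real (card ?U)"
    by (simp add: sum.distrib sum_distrib_left sum_distrib_right sum_divide_distrib divide_inverse
        algebra_simps flip: sum_divide_distrib)
  \<comment> \<open>The factor \<open>2\<close> of the induction hypothesis cancels against the
    halving of the list.\<close>
  also have "\<dots> \<le> (real (card ?U) * real (length M) * ?B +
      real (length M * card ?U) * ?B) / real (card ?U)"
    using sum_length_fixed_le[OF Suc.prems]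
    by (intro divide_right_mono add_left_mono mult_right_mono) (auto simp del: of_nat_mult)
  also have "\<dots> = 2 * real (length M) * ?B"
    using U by (simp add: field_simps)
  finally show ?case .
qed

end

section \<open>Precomputation and bounds for the whole algorithm\<close>

context quotient_multiplication
begin

lemma precomputation_eq:
  fixes xi e
  defines "xi \<equiv> pad_poly L m (pmod X f)" and "e \<equiv> pad_poly L m [\<one>]"
  defines "B \<equiv> \<lambda>p. square_multiply (slp_mult L P) e xi (card K ^ (m div p))"
  shows "precomputation L K m f P =
    (map (\<lambda>p. (p, fst (B p))) (sorted_list_of_set (prime_factors m)),
     \<Sum>p\<leftarrow>sorted_list_of_set (prime_factors m). snd (B p))"
  by (simp add: precomputation_def Let_def B_def xi_def e_def zip_map2 zip_same_conv_map comp_def)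

lemma length_fst_precomputation:
  "length (fst (precomputation L K m f P)) = card (prime_factors m)"
  by (simp add: precomputation_eq)

lemma set_fst_precomputation: "fst ` set (fst (precomputation L K m f P)) = prime_factors m"
  by (simp add: precomputation_eq image_image)

text \<open>The power computation starts from \<open>pmod X f\<close>, since \<open>X\<close> itself
  has degree below \<open>m\<close> only when \<open>m > 1\<close>. Its value at
  \<open>\<alpha>\<close> is \<open>\<alpha>\<close> by division with remainder and
  \<open>f(\<alpha>) = 0\<close>.\<close>

lemma correct_powers_precomputation: "correct_powers (fst (precomputation L K m f P))"
proof -
  interpret UP: domain "K[X]" by (rule univ_poly_is_domain[OF subring])
  interpret ev: ring_hom_ring "K[X]" L "\<lambda>p. eval p \<alpha>"
    by (rule eval_ring_hom[OF subring root_closed])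
  define xi where "xi = pad_poly L m (pmod X f)"
  have X: "X \<in> carrier (K[X])" by (rule var_closed(1)[OF subring])
  note c = long_division_closed[OF subfield X f_closed]
  have below: "pmod X f \<in> polys_below L K m"
    using c(2) pmod_degree[OF subfield X f_closed f_nonzero] degree_f m_pos
    by (auto simp: polys_below_def)
  have "eval X \<alpha> = eval f \<alpha> \<otimes> eval (pdiv X f) \<alpha> \<oplus> eval (pmod X f) \<alpha>"
    using arg_cong[OF pdiv_pmod[OF subfield X f_closed], of "\<lambda>p. eval p \<alpha>"] c f_closed by simp
  hence "eval (pmod X f) \<alpha> = \<alpha>"
    using c root eval_poly_closed root_closed eval_var[OF root_closed] by simp
  moreover have "eval xi \<alpha> = eval (pmod X f) \<alpha>"
    unfolding xi_def using eval_pad_poly poly_set[OF c(2)] K_subset root_closed by blast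
  ultimately have xi: "xi \<in> coeff_vecs K m" "eval xi \<alpha> = \<alpha>"
    using pad_poly_coeff_vecs[OF below] unfolding xi_def by auto
  have "card K ^ j \<ge> 1" for j using card_K by simp
  thus ?thesis
    using square_multiply_correct[OF xi(1)]
    unfolding correct_powers_def precomputation_eq xi_def[symmetric] by (auto simp: xi(2))
qed

lemma answer_correct:
  assumes us: "us \<noteq> []" "set us \<subseteq> polys_below L K m"
  shows "answer L K m f P us \<longleftrightarrow> generate_field L (K \<union> (\<lambda>u. eval u \<alpha>) ` set us) = carrier L"
proof -
  let ?M = "fst (precomputation L K m f P)"
  have sub: "(\<lambda>u. eval u \<alpha>) ` set us \<subseteq> carrier L"
    using us(2) eval_poly_closed root_closed by (auto simp: polys_below_def)
  have "answer L K m f P us \<longleftrightarrow> fst (verification_loop L m P ?M us)"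
    by (simp add: answer_def field_degree_verification_def case_prod_beta)
  also have "\<dots> \<longleftrightarrow> (\<forall>p \<in> fst ` set ?M. \<exists>u \<in> set us. \<not> fixes_power p (eval u \<alpha>))"
    using fst_verification_loop[OF correct_powers_precomputation us(2)] us(1) by auto
  also have "\<dots> \<longleftrightarrow> generate_field L (K \<union> (\<lambda>u. eval u \<alpha>) ` set us) = carrier L"
    unfolding set_fst_precomputation generate_field_eq_carrier_iff[OF sub] by auto
  finally show ?thesis .
qed

text \<open>At most \<open>log 2 m\<close> powers are computed, each with exponent
  \<open>q^(m/p)\<close>, whose logarithm is crudely bounded through
  \<open>m/p \<le> m\<close>.\<close>

lemma precomputation_cost_le:
  "real (precomputation_cost L K m f P us) \<le>
     log 2 (real m) * (2 * real (slp_cost P) * (real m * log 2 (real (card K))))"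
proof -
  let ?ps = "sorted_list_of_set (prime_factors m)"
  let ?B = "\<lambda>p. square_multiply (slp_mult L P) (pad_poly L m [\<one>]) (pad_poly L m (pmod X f))
      (card K ^ (m div p))"
  have q: "0 \<le> log 2 (real (card K))" using card_K by simp
  have "real (snd (?B p)) \<le> 2 * real (slp_cost P) * (real m * log 2 (real (card K)))" for p
  proof -
    have "real (snd (?B p)) \<le> 2 * real (slp_cost P) * log 2 (real (card K ^ (m div p)))"
      by (rule square_multiply_cost_le) (use card_K in \<open>simp_all add: slp_mult_def\<close>)
    also have "log 2 (real (card K ^ (m div p))) = real (m div p) * log 2 (real (card K))"
      using card_K by (simp add: log_nat_power)
    also have "\<dots> \<le> real m * log 2 (real (card K))"
      using q by (intro mult_right_mono) auto
    finally show ?thesis by (simp add: mult_left_mono)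
  qed
  hence "real (\<Sum>p\<leftarrow>ps. snd (?B p)) \<le>
      real (length ps) * (2 * real (slp_cost P) * (real m * log 2 (real (card K))))" for ps
    by (induction ps) (simp_all add: distrib_right add_mono)
  from this[of ?ps] have "real (\<Sum>p\<leftarrow>?ps. snd (?B p)) \<le>
      real (card (prime_factors m)) * (2 * real (slp_cost P) * (real m * log 2 (real (card K))))"
    by simp
  also have "\<dots> \<le> log 2 (real m) * (2 * real (slp_cost P) * (real m * log 2 (real (card K))))"
    using q card_prime_factors_le_log[OF m_pos] by (intro mult_right_mono) auto
  finally show ?thesis
    by (simp add: precomputation_cost_def field_degree_verification_def case_prod_beta precomputation_eq)
qed

lemma main_cost_eq:
  "main_cost L K m f P us = snd (verification_loop L m P (fst (precomputation L K m f P)) us)"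
  by (simp add: main_cost_def field_degree_verification_def case_prod_beta)

lemma main_cost_le:
  assumes us: "set us \<subseteq> polys_below L K m"
  shows "real (main_cost L K m f P us) \<le>
    real (length us) * (log 2 (real m) * (real m * (real (slp_cost P) + 2)))"
proof -
  have "\<forall>u \<in> set us. degree u \<le> m" using us by (auto simp: polys_below_def)
  hence "main_cost L K m f P us \<le> length us * (card (prime_factors m) * (m * (slp_cost P + 2)))"
    unfolding main_cost_eq
    using verification_loop_cost_le[of us m L P "fst (precomputation L K m f P)"]
    by (simp add: length_fst_precomputation)
  hence "real (main_cost L K m f P us) \<le>
      real (length us * (card (prime_factors m) * (m * (slp_cost P + 2))))"
    by (rule of_nat_mono)
  also have "\<dots> = real (length us) * (real (card (prime_factors m)) * (real m * (real (slp_cost P) + 2)))"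
    by (simp add: algebra_simps)
  also have "\<dots> \<le> real (length us) * (log 2 (real m) * (real m * (real (slp_cost P) + 2)))"
    using card_prime_factors_le_log[OF m_pos] by (intro mult_left_mono mult_right_mono) auto
  finally show ?thesis .
qed

lemma expected_main_cost_le:
  "measure_pmf.expectation (replicate_pmf r (pmf_of_set (polys_below L K m)))
      (\<lambda>us. real (main_cost L K m f P us))
    \<le> 2 * (log 2 (real m) * (real m * (real (slp_cost P) + 2)))"
proof -
  have "measure_pmf.expectation (replicate_pmf r (pmf_of_set (polys_below L K m)))
      (\<lambda>us. real (main_cost L K m f P us))
    \<le> 2 * (real (card (prime_factors m)) * (real m * (real (slp_cost P) + 2)))"
    using expected_verification_loop_cost_le[OF correct_powers_precomputation, of r]
    by (simp add: main_cost_eq length_fst_precomputation algebra_simps)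
  also have "\<dots> \<le> 2 * (log 2 (real m) * (real m * (real (slp_cost P) + 2)))"
    using card_prime_factors_le_log[OF m_pos] by (intro mult_left_mono mult_right_mono) auto
  finally show ?thesis .
qed

end

text \<open>
  Without instructions every output is an input coefficient or a constant. All constants are zero
  because the product of zero polynomials is zero, and no input coefficient is output, because
  the product with the zero polynomial is zero.
\<close>

lemma poly_mult_slp_cost_pos:
  fixes R :: "'a ring" (structure)
  assumes R: "field R" and K: "subfield K R" and n: "1 \<le> n" and P: "poly_mult_slp R K n P"
  shows "1 \<le> slp_cost P"
proof (rule ccontr)
  assume "\<not> 1 \<le> slp_cost P"
  hence nil: "fst P = []" by (cases "fst P") (simp_all add: slp_cost_def)
  interpret field R by (rule R)
  note sub = subfieldE(1)[OF K]
  interpret UP: domain "K[X]" by (rule univ_poly_is_domain[OF sub])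
  let ?o = "replicate n \<one>" and ?z = "replicate n \<zero>"
  have vecs: "?o \<in> coeff_vecs K n" "?z \<in> coeff_vecs K n"
    using subringE(2,3)[OF sub] by (auto simp: coeff_vecs_def)
  have run: "run_slp R P xs = map (operand_val xs) (snd P)" for xs
    by (simp add: run_slp_def nil)
  have mult: "normalize (map (operand_val (a @ b)) (snd P)) = normalize a \<otimes>\<^bsub>K[X]\<^esub> normalize b"
    if "a \<in> coeff_vecs K n" "b \<in> coeff_vecs K n" for a b
    using P that unfolding poly_mult_slp_def run by blast
  have nz: "normalize ?z = []" using normalize_replicate_zero[of n "[]"] by simp
  have no: "normalize ?o = ?o" using n by (cases n) simp_all
  have o_closed: "?o \<in> carrier (K[X])"
    using n subringE(3)[OF sub] by (auto simp: univ_poly_carrier[symmetric] polynomial_def)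
  have zero_out: "operand_val xs s = \<zero>"
    if "normalize (map (operand_val xs) (snd P)) = []" "s \<in> set (snd P)" for xs s
    using normalize_def'(1)[of "map (operand_val xs) (snd P)"] that
    by (metis append_Nil2 diff_zero drop_all in_set_conv_nth in_set_replicate length_map list.size(3)
        nth_map nth_mem order_refl)
  have nilmult: "[] \<otimes>\<^bsub>K[X]\<^esub> p = []" "p \<otimes>\<^bsub>K[X]\<^esub> [] = []" if "p \<in> carrier (K[X])" for p
    using UP.l_null[OF that] UP.r_null[OF that] by (simp_all add: univ_poly_zero)
  have nil_closed: "[] \<in> carrier (K[X])" using UP.zero_closed by (simp add: univ_poly_zero)
  have zz: "operand_val (?z @ ?z) s = \<zero>" and oz: "operand_val (?o @ ?z) s = \<zero>"
    and zo: "operand_val (?z @ ?o) s = \<zero>" if "s \<in> set (snd P)" for s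
    using zero_out[OF _ that] mult[OF vecs(2,2)] mult[OF vecs(1,2)] mult[OF vecs(2,1)]
      nilmult o_closed nil_closed nz no by auto
  have "operand_val (?o @ ?o) s = \<zero>" if s: "s \<in> set (snd P)" for s
  proof (cases s)
    case (Reg i)
    have "i < 2 * n" using P s nil Reg unfolding poly_mult_slp_def slp_over_def by auto
    \<comment> \<open>Every input position carries a one in one of these two inputs, while both must
      produce only zeros.\<close>
    hence "(?o @ ?z) ! i = \<one> \<or> (?z @ ?o) ! i = \<one>" by (auto simp: nth_append)
    thus ?thesis using oz[OF s] zo[OF s] Reg by auto
  next
    case (Cst a)
    thus ?thesis using zz[OF s] by simp
  qed
  hence "map (operand_val (?o @ ?o)) (snd P) = replicate (length (snd P)) \<zero> @ []"
    by (simp add: map_replicate_const[symmetric])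
  hence "normalize (map (operand_val (?o @ ?o)) (snd P)) = []"
    using normalize_replicate_zero[of "length (snd P)" "[]"] by simp
  \<comment> \<open>The all-ones polynomial would square to zero, although it is nonzero and the
    polynomial ring is a domain.\<close>
  hence "?o \<otimes>\<^bsub>K[X]\<^esub> ?o = \<zero>\<^bsub>K[X]\<^esub>" using mult[OF vecs(1,1)] no by (simp add: univ_poly_zero)
  hence "?o = []" using UP.integral[OF _ o_closed o_closed] by (simp add: univ_poly_zero)
  thus False using n by simp
qed

section \<open>Uniform constants\<close>

text \<open>Here \<open>c\<close> is the constant in the assumption that \<open>P\<close> costs
  O(M(m)). The constant \<open>C\<close> depends on \<open>c\<close> alone, so the bounds are
  uniform in the fields and all inputs. For \<open>m = 1\<close> they are zero, as are the costs,
  since there are no prime factors.\<close>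

theorem proposition3p8:
  fixes c :: real
  shows "\<exists>C > 0. \<forall>(L :: 'a ring) K m r f \<alpha> M P.
    field L \<and> finite (carrier L) \<and> subfield K L \<and>
    1 \<le> m \<and> 1 \<le> r \<and> card (carrier L) = card K ^ m \<and>
    f \<in> carrier (K[X]\<^bsub>L\<^esub>) \<and> pirreducible\<^bsub>L\<^esub> K f \<and> lead_coeff f = \<one>\<^bsub>L\<^esub> \<and> degree f = m \<and>
    \<alpha> \<in> carrier L \<and> ring.eval L f \<alpha> = \<zero>\<^bsub>L\<^esub> \<and>
    mult_time L K M \<and> quot_mult_slp L K f P \<and> real (slp_cost P) \<le> c * real (M m)
    \<longrightarrow>
    (\<forall>us. length us = r \<and> set us \<subseteq> polys_below L K m \<longrightarrow>
       (answer L K m f P us \<longleftrightarrow>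
          generate_field L (K \<union> (\<lambda>u. ring.eval L u \<alpha>) ` set us) = carrier L) \<and>
       real (precomputation_cost L K m f P us)
         \<le> C * (real m * ln (real m) * ln (real (card K)) * real (M m)) \<and>
       real (main_cost L K m f P us)
         \<le> C * (real r * real m * ln (real m) * real (M m))) \<and>
    measure_pmf.expectation (replicate_pmf r (pmf_of_set (polys_below L K m)))
        (\<lambda>us. real (main_cost L K m f P us))
      \<le> C * (real m * ln (real m) * real (M m))"
proof -
  \<comment> \<open>In \<open>A\<close>, the absolute value allows any real \<open>c\<close> and
    \<open>2\<close> covers additions and comparisons. In \<open>C\<close>, the two factors
    \<open>ln 2\<close> convert the two binary logarithms of the precomputation; the other bounds
    have one logarithm, and \<open>ln 2 < 1\<close> lets the same \<open>C\<close> serve.\<close>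
  define A where "A = \<bar>c\<bar> + 2"
  define C where "C = 2 * A / (ln 2)\<^sup>2"
  have ln2: "0 < ln (2::real)" "ln (2::real) < 1"
    using ln_2_less_1 by simp_all
  have A: "A > 0" by (simp add: A_def)
  hence C: "C > 0" using ln2 by (simp add: C_def)
  have CA: "2 * A / ln 2 \<le> C"
    unfolding C_def using A ln2 by (intro divide_left_mono) (auto simp: power2_eq_square)
  show ?thesis
  proof (intro exI[of _ C] conjI[OF C] allI impI, elim conjE)
    fix L :: "'a ring" and K m r f \<alpha> M P
    assume h: "field L" "finite (carrier L)" "subfield K L" "1 \<le> m" "1 \<le> (r::nat)"
      "card (carrier L) = card K ^ m" "f \<in> carrier (K[X]\<^bsub>L\<^esub>)" "pirreducible\<^bsub>L\<^esub> K f"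
      "lead_coeff f = \<one>\<^bsub>L\<^esub>" "degree f = m" "\<alpha> \<in> carrier L" "ring.eval L f \<alpha> = \<zero>\<^bsub>L\<^esub>"
      "mult_time L K M" "quot_mult_slp L K f P" "real (slp_cost P) \<le> c * real (M m)"
    interpret field L by (rule h(1))
    interpret quotient_multiplication L K m f \<alpha> P
      by (intro quotient_multiplication.intro monic_irreducible_root.intro
          monic_irreducible_root_axioms.intro quotient_multiplication_axioms.intro h)
    \<comment> \<open>A multiplication program within the bound \<open>M m\<close> needs at least
      one instruction, so \<open>M m \<ge> 1\<close> and additive constants can be absorbed into a
      multiple of \<open>M m\<close>.\<close>
    obtain P' where "poly_mult_slp L K m P'" "slp_cost P' \<le> M m"
      using h(4,13) unfolding mult_time_def by blast
    hence "1 \<le> M m" using poly_mult_slp_cost_pos[OF h(1) subfield m_pos] by fastforce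
    hence M: "1 \<le> real (M m)" by simp
    have "c * real (M m) \<le> \<bar>c\<bar> * real (M m)" by (intro mult_right_mono) auto
    hence cost: "real (slp_cost P) + 2 \<le> A * real (M m)"
      using h(15) M unfolding A_def distrib_right by linarith
    hence cost': "real (slp_cost P) \<le> A * real (M m)" by simp
    have lnm: "0 \<le> ln (real m)" using m_pos by simp
    have lnq: "0 \<le> ln (real (card K))" using card_K by simp
    have round: "2 * (log 2 (real m) * (real m * (real (slp_cost P) + 2)))
        \<le> C * (real m * ln (real m) * real (M m))"
    proof -
      have "2 * (log 2 (real m) * (real m * (real (slp_cost P) + 2)))
          \<le> 2 * (log 2 (real m) * (real m * (A * real (M m))))"
        using cost lnm ln2 by (intro mult_left_mono) (auto simp: log_def)
      also have "\<dots> = 2 * A / ln 2 * (real m * ln (real m) * real (M m))"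
        by (simp add: log_def field_simps)
      also have "\<dots> \<le> C * (real m * ln (real m) * real (M m))"
        using lnm by (intro mult_right_mono[OF CA]) auto
      finally show ?thesis .
    qed
    have "real (precomputation_cost L K m f P us)
        \<le> C * (real m * ln (real m) * ln (real (card K)) * real (M m))" for us
    proof -
      have "real (precomputation_cost L K m f P us) \<le>
          log 2 (real m) * (2 * real (slp_cost P) * (real m * log 2 (real (card K))))"
        by (rule precomputation_cost_le)
      also have "\<dots> \<le> log 2 (real m) * (2 * (A * real (M m)) * (real m * log 2 (real (card K))))"
        using cost' lnm lnq ln2 by (intro mult_left_mono mult_right_mono) (auto simp: log_def)
      also have "\<dots> = C * (real m * ln (real m) * ln (real (card K)) * real (M m))"
        unfolding log_def C_def power2_eq_square times_divide_eq_left times_divide_eq_right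
          divide_divide_eq_left by (simp only: mult_ac)
      finally show ?thesis .
    qed
    moreover have "real (main_cost L K m f P us) \<le> C * (real r * real m * ln (real m) * real (M m))"
      if us: "length us = r" "set us \<subseteq> polys_below L K m" for us
    proof -
      have "real (main_cost L K m f P us) \<le> real r * (log 2 (real m) * (real m * (real (slp_cost P) + 2)))"
        using main_cost_le[OF us(2)] us(1) by simp
      \<comment> \<open>Doubling the worst-case bound for one round allows \<open>round\<close>,
        shaped for the average case, to be reused.\<close>
      also have "\<dots> \<le> real r * (2 * (log 2 (real m) * (real m * (real (slp_cost P) + 2))))"
      proof (rule mult_left_mono)
        have "0 \<le> log 2 (real m) * (real m * (real (slp_cost P) + 2))"
          using m_pos by simp
        thus "log 2 (real m) * (real m * (real (slp_cost P) + 2)) \<le>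
            2 * (log 2 (real m) * (real m * (real (slp_cost P) + 2)))" by linarith
      qed simp
      also have "\<dots> \<le> real r * (C * (real m * ln (real m) * real (M m)))"
        by (intro mult_left_mono[OF round]) auto
      finally show ?thesis by (simp add: mult_ac)
    qed
    moreover have "answer L K m f P us \<longleftrightarrow>
        generate_field L (K \<union> (\<lambda>u. ring.eval L u \<alpha>) ` set us) = carrier L"
      if us: "length us = r" "set us \<subseteq> polys_below L K m" for us
    proof (rule answer_correct[OF _ us(2)])
      show "us \<noteq> []" using us(1) h(5) by auto
    qed
    ultimately show "(\<forall>us. length us = r \<and> set us \<subseteq> polys_below L K m \<longrightarrow>
       (answer L K m f P us \<longleftrightarrow>
          generate_field L (K \<union> (\<lambda>u. ring.eval L u \<alpha>) ` set us) = carrier L) \<and>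
       real (precomputation_cost L K m f P us)
         \<le> C * (real m * ln (real m) * ln (real (card K)) * real (M m)) \<and>
       real (main_cost L K m f P us)
         \<le> C * (real r * real m * ln (real m) * real (M m))) \<and>
    measure_pmf.expectation (replicate_pmf r (pmf_of_set (polys_below L K m)))
        (\<lambda>us. real (main_cost L K m f P us))
      \<le> C * (real m * ln (real m) * real (M m))"
      using order_trans[OF expected_main_cost_le round] by blast
  qed
qed

end
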